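(* Let $(P,\le_P)$ be a finite (3+1)-free poset. For $T$ a two-row $P$-tableau we have \[s_{\mathbf{wt}(T)}=\sum_{A\in\mathrm{DFA}_{P,T}}\ \prod_{i\ge1}x_i^{\mathbf{wt}(A)_i},\] where $s_\lambda$ denotes the Schur function indexed by the partition $\lambda$.
   Context: A poset is (3+1)-free if it does not contain as an induced subposet the disjoint union of a 3-element chain and a 1-element chain. $\mathbb Z_+$ is the set of positive integers. Positions $(i,j)\in\mathbb Z_+\times\mathbb Z_+$ use matrix convention (row $i$, column $j$; row 1 on top). $P$-arrays. A $P$-array is an indexing $A=\{A_{i,j}\}$ of the elements of $P$ (each element of $P$ occurs exactly once) by positions $(i,j)$ such that if $A_{i,j}$ is defined with $j>1$ then $A_{i,j-1}$ is defined and $A_{i,j-1}<_P A_{i,j}$. $\mathbf{wt}(A)_i$ is the number of elements in row $i$. A $P$-tableau is a $P$-array such that whenever $A_{i,j}$ is defined with $i>1$, then $A_{i-1,j}$ is defined and $A_{i-1,j}\not>_P A_{i,j}$ (its weight is then a partition). A two-row $P$-tableau is a $P$-tableau $T$ with $\mathbf{wt}(T)_i=0$ for all $i>2$. The 1 alignment. Let $T$ be a $P$-array with elements $a_1<_P\cdots<_Pa_m$ in row 1 and $b_1<_P\cdots<_Pb_n$ in row 2. Define $C(b_k)=k$ and, inductively, $C(a_k)=\max(\{C(b_i)\mid b_i<_Pa_k\}\cup\{C(a_i)\mid 1\le i<k\})+1$ (with $\max\emptyset=0$). Let $\phi_0:\{a_1,\dots,a_m,b_1,\dots,b_n\}\to\{1,2\}\times\mathbb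 Z_+$ send $a_k\mapsto(1,C(a_k))$, $b_k\mapsto(2,C(b_k))$. Given $\phi_k$, select the rightmost element $x$, say mapped to $(i,c)$, such that column $c+1$ of $\phi_k$ is nonempty and contains no $y>_Px$, if such $x$ exists; then $\phi_{k+1}(x)=(i,c+1)$ and $\phi_{k+1}=\phi_k$ elsewhere. If no such $x$ exists, $\phi_k$ is the 1 alignment of $T$. Diagram crystal. A diagram is a finite subset of $\mathbb Z_+\times\mathbb Z_+$, whose elements are called cells. The $r$-pairs of a diagram $D$ are defined iteratively: unpaired cells $x$ in row $r$ and $y$ in row $r+1$, with $x$ weakly left of $y$, form an $r$-pair whenever every other cell in rows $r,r+1$ in a column weakly between $x$ and $y$ is already part of an $r$-pair. If every cell in row $r+1$ of $D$ is $r$-paired then $e_r(D)=0$; otherwise, with $(r+1,c)$ the rightmost non-$r$-paired cell in row $r+1$, $e_r(D)=(D\setminus\{(r+1,c)\})\cup\{(r,c)\}$. If every cell in row $r$ is $r$-paired then $f_r(D)=0$; otherwise, with $(r,c)$ the leftmost non-$r$-paired cell in row $r$, $f_r(D)=(D\setminus\{(r,c)\})\cup\{(r+1,c)\}$. The diagram crystal is the graph on all diagrams with an edge of color $r$ from $D$ to $f_r(D)$ whenever $f_r(D)\ne0$ (equivalently from $e_r(D)$ to $D$ whenever $e_r(D)\neq 0$). For a two-row $P$-tableau $T$, let $\mathbb D(T)$ be the image of the 1 alignment of $T$, and let $\mathcal D(T)$ be the set of diagrams in the connected component of $\mathbb D(T)$ in the diagram crystal. Diagram filling. For $D\in\mathcal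 D(T)$, the filling $L_T(D):P\to D$ is the bijection constructed column by column from left to right as follows (each column of $D$ has the same number of cells, at most 2, as the same column of $\mathbb D(T)$). Suppose all entries mapped to cells strictly left of column $c$ are determined. If column $c$ of the 1 alignment of $T$ contains a unique entry, map it to the unique cell in column $c$ of $D$. Otherwise column $c$ of the 1 alignment contains two entries $x_1,x_2$ in rows 1 and 2 respectively; assign them to the two cells in column $c$ of $D$ by the first of the following rules whose prerequisites are met. (1) Suppose some $y\in P$ is mapped to the topmost cell $(r,c-1)$ in column $c-1$ of $D$, and exactly one $x_i$ is greater than $y$ in $P$. Then let $s\le r$ be maximal such that $(s,c)\in D$, map $x_i$ to $(s,c)$ and the remaining element to the remaining cell. (2) The same with "topmost" replaced by "lowest": suppose some $y\in P$ is mapped to the lowest cell $(r,c-1)$ in column $c-1$ of $D$, and exactly one $x_i$ is greater than $y$; then let $s\le r$ be maximal such that $(s,c)\in D$, map $x_i$ to $(s,c)$ and the remaining element to the remaining cell. (3) Map $x_1$ and $x_2$ to the upper and lower cells in column $c$ of $D$ respectively. For a filling $L=L_T(D)$, $\mathrm{array}(L)$ is the $P$-array $\{A_{i,j}\}$ where $L(A_{i,j})$ is the $j$th cell from the left in row $i$ of $\operatorname{Im}(L)=D$. Set $\mathrm{DFA}_{P,T}=\{\mathrm{array}(L_T(D))\mid D\in\mathcal D(T)\}$. *)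

theory Defs
  imports
    "HOL-Analysis.Analysis"
    "HOL-Library.Poly_Mapping"
    "HOL-Library.While_Combinator"
begin

text \<open>
  A poset is a carrier \<open>P\<close> with a relation \<open>r\<close> such that \<open>partial_order_on P r\<close>; its
  strict order is \<open>r - Id\<close>. Rows, columns and variable indices are positive integers,
  represented as natural numbers that are at least 1.
\<close>

type_synonym cell = "nat \<times> nat"
type_synonym 'a parray = "cell \<rightharpoonup> 'a"

abbreviation lt :: "'a rel \<Rightarrow> 'a \<Rightarrow> 'a \<Rightarrow> bool" where
  "lt r x y \<equiv> (x, y) \<in> r - Id"

definition three_plus_one_free :: "'a set \<Rightarrow> 'a rel \<Rightarrow> bool" where
  "three_plus_one_free P r \<longleftrightarrow>
    \<not> (\<exists>a\<in>P. \<exists>b\<in>P. \<exists>c\<in>P. \<exists>d\<in>P. lt r a b \<and> lt r b c \<and>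
        (\<forall>x\<in>{a, b, c}. (x, d) \<notin> r \<and> (d, x) \<notin> r))"


section \<open>Arrays and tableaux\<close>

definition P_array :: "'a set \<Rightarrow> 'a rel \<Rightarrow> 'a parray \<Rightarrow> bool" where
  "P_array P r A \<longleftrightarrow>
    dom A \<subseteq> {1..} \<times> {1..} \<and> ran A = P \<and> inj_on A (dom A) \<and>
    (\<forall>i j x. A (i, j) = Some x \<and> j > 1 \<longrightarrow> (\<exists>y. A (i, j - 1) = Some y \<and> lt r y x))"

definition P_tableau :: "'a set \<Rightarrow> 'a rel \<Rightarrow> 'a parray \<Rightarrow> bool" where
  "P_tableau P r A \<longleftrightarrow> P_array P r A \<and>
    (\<forall>i j x. A (i, j) = Some x \<and> i > 1 \<longrightarrow> (\<exists>y. A (i - 1, j) = Some y \<and> \<not> lt r x y))"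

definition wt :: "'a parray \<Rightarrow> nat \<Rightarrow> nat" where
  "wt A i = card {j. (i, j) \<in> dom A}"

definition two_row_tableau :: "'a set \<Rightarrow> 'a rel \<Rightarrow> 'a parray \<Rightarrow> bool" where
  "two_row_tableau P r T \<longleftrightarrow> P_tableau P r T \<and> (\<forall>i>2. wt T i = 0)"


section \<open>The 1 alignment\<close>

text \<open>\<open>C_row1 r T k\<close> is $C(a_k)$; the values $C(b_i)=i$ are inlined.\<close>

fun C_row1 :: "'a rel \<Rightarrow> 'a parray \<Rightarrow> nat \<Rightarrow> nat" where
  "C_row1 r T k =
    Max ({0} \<union> {i. \<exists>a b. T (1, k) = Some a \<and> T (2, i) = Some b \<and> lt r b a}
             \<union> C_row1 r T ` {1..<k}) + 1"

declare C_row1.simps [simp del]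

definition phi0 :: "'a rel \<Rightarrow> 'a parray \<Rightarrow> 'a \<Rightarrow> cell" where
  "phi0 r T x = (let (i, k) = (THE p. T p = Some x) in if i = 1 then (1, C_row1 r T k) else (i, k))"

definition movable :: "'a set \<Rightarrow> 'a rel \<Rightarrow> ('a \<Rightarrow> cell) \<Rightarrow> 'a set" where
  "movable P r \<phi> = {x \<in> P.
     (\<exists>y\<in>P. snd (\<phi> y) = snd (\<phi> x) + 1) \<and>
     \<not> (\<exists>y\<in>P. snd (\<phi> y) = snd (\<phi> x) + 1 \<and> lt r x y)}"

text \<open>
  The rightmost movable element is unique: every row is increasing from left to right, so an
  element is not movable if the next column meets its own row. Hence \<open>arg_max\<close> makes no choice.
\<close>

definition align_step :: "'a set \<Rightarrow> 'a rel \<Rightarrow> ('a \<Rightarrow> cell) \<Rightarrow> ('a \<Rightarrow> cell)" where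
  "align_step P r \<phi> =
    (let x = arg_max (\<lambda>x. snd (\<phi> x)) (\<lambda>x. x \<in> movable P r \<phi>)
     in \<phi>(x := (fst (\<phi> x), snd (\<phi> x) + 1)))"

definition alignment :: "'a set \<Rightarrow> 'a rel \<Rightarrow> 'a parray \<Rightarrow> 'a \<Rightarrow> cell" where
  "alignment P r T = while (\<lambda>\<phi>. movable P r \<phi> \<noteq> {}) (align_step P r) (phi0 r T)"


section \<open>The diagram crystal\<close>

definition diagram :: "cell set \<Rightarrow> bool" where
  "diagram D \<longleftrightarrow> finite D \<and> D \<subseteq> {1..} \<times> {1..}"

text \<open>
  \<open>pairing D k S\<close>: \<open>S\<close> is a set of pairs formed at some stage of the iterative \<open>k\<close>-pairing of
  \<open>D\<close>; \<open>Field S\<close> is the set of cells occurring in it. The process is confluent (it is bracket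
  matching), so the order in which pairs are formed is immaterial.
\<close>

inductive pairing :: "cell set \<Rightarrow> nat \<Rightarrow> cell rel \<Rightarrow> bool" for D k where
  empty: "pairing D k {}"
| step: "pairing D k (insert ((k, c), (k + 1, c')) S)"
  if "pairing D k S" "(k, c) \<in> D" "(k + 1, c') \<in> D" "c \<le> c'"
     "(k, c) \<notin> Field S" "(k + 1, c') \<notin> Field S"
     "\<forall>(i, j) \<in> D - {(k, c), (k + 1, c')}. i \<in> {k, k + 1} \<and> c \<le> j \<and> j \<le> c' \<longrightarrow> (i, j) \<in> Field S"

definition paired :: "cell set \<Rightarrow> nat \<Rightarrow> cell \<Rightarrow> bool" where
  "paired D k x \<longleftrightarrow> (\<exists>S. pairing D k S \<and> x \<in> Field S)"

text \<open>\<open>None\<close> stands for the value $0$ of the crystal operator.\<close>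

definition crystal_f :: "nat \<Rightarrow> cell set \<Rightarrow> cell set option" where
  "crystal_f k D =
    (let U = {c. (k, c) \<in> D \<and> \<not> paired D k (k, c)}
     in if U = {} then None else Some (D - {(k, Min U)} \<union> {(k + 1, Min U)}))"

definition crystal_edge :: "cell set \<Rightarrow> cell set \<Rightarrow> bool" where
  "crystal_edge D D' \<longleftrightarrow> diagram D \<and> diagram D' \<and> (\<exists>k\<ge>1. crystal_f k D = Some D')"

definition crystal_component :: "'a set \<Rightarrow> 'a rel \<Rightarrow> 'a parray \<Rightarrow> cell set set" where
  "crystal_component P r T = {D. equivclp crystal_edge (alignment P r T ` P) D}"


section \<open>Diagram fillings\<close>

text \<open>
  In the next three definitions \<open>L\<close> is the part of the filling constructed in the columns
  strictly left of \<open>c\<close>, \<open>X\<close> is the set of entries of column \<open>c\<close> of the 1 alignment, and \<open>q\<close> is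
  the topmost or the lowest cell of column \<open>c - 1\<close> of the diagram.
\<close>

definition rule_applies :: "'a rel \<Rightarrow> ('a \<rightharpoonup> cell) \<Rightarrow> 'a set \<Rightarrow> cell \<Rightarrow> bool" where
  "rule_applies r L X q \<longleftrightarrow> (\<exists>y. L y = Some q \<and> (\<exists>!x. x \<in> X \<and> lt r y x))"

definition place_by :: "'a rel \<Rightarrow> cell set \<Rightarrow> ('a \<rightharpoonup> cell) \<Rightarrow> 'a set \<Rightarrow> nat \<Rightarrow> cell \<Rightarrow> ('a \<rightharpoonup> cell)" where
  "place_by r D L X c q =
    (let y = (THE y. L y = Some q);
         x = (THE x. x \<in> X \<and> lt r y x);
         x' = the_elem (X - {x});
         s = Max {s. s \<le> fst q \<and> (s, c) \<in> D};
         s' = the_elem ({i. (i, c) \<in> D} - {s})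
     in [x \<mapsto> (s, c), x' \<mapsto> (s', c)])"

definition column_filling ::
    "'a set \<Rightarrow> 'a rel \<Rightarrow> 'a parray \<Rightarrow> cell set \<Rightarrow> ('a \<rightharpoonup> cell) \<Rightarrow> nat \<Rightarrow> ('a \<rightharpoonup> cell)" where
  "column_filling P r T D L c =
    (let \<phi> = alignment P r T;
         X = {x \<in> P. snd (\<phi> x) = c};
         R = {i. (i, c) \<in> D};
         R' = {i. (i, c - 1) \<in> D};
         top = (Min R', c - 1);
         low = (Max R', c - 1)
     in if X = {} then Map.empty
        else if card X = 1 then [the_elem X \<mapsto> (the_elem R, c)]
        else if R' \<noteq> {} \<and> rule_applies r L X top then place_by r D L X c top
        else if R' \<noteq> {} \<and> rule_applies r L X low then place_by r D L X c low
        else [(THE x. x \<in> P \<and> \<phi> x = (1, c)) \<mapsto> (Min R, c),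
              (THE x. x \<in> P \<and> \<phi> x = (2, c)) \<mapsto> (Max R, c)])"

primrec filling_upto ::
    "'a set \<Rightarrow> 'a rel \<Rightarrow> 'a parray \<Rightarrow> cell set \<Rightarrow> nat \<Rightarrow> ('a \<rightharpoonup> cell)" where
  "filling_upto P r T D 0 = Map.empty"
| "filling_upto P r T D (Suc c) =
    filling_upto P r T D c ++ column_filling P r T D (filling_upto P r T D c) (Suc c)"

definition filling :: "'a set \<Rightarrow> 'a rel \<Rightarrow> 'a parray \<Rightarrow> cell set \<Rightarrow> 'a \<Rightarrow> cell" where
  "filling P r T D x = the (filling_upto P r T D (snd (alignment P r T x)) x)"

definition array_of :: "'a set \<Rightarrow> ('a \<Rightarrow> cell) \<Rightarrow> 'a parray" where
  "array_of P L = (\<lambda>(i, j).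
    let cs = sorted_list_of_set {c. (i, c) \<in> L ` P}
    in if 1 \<le> j \<and> j \<le> length cs then Some (inv_into P L (i, cs ! (j - 1))) else None)"

definition DFA :: "'a set \<Rightarrow> 'a rel \<Rightarrow> 'a parray \<Rightarrow> 'a parray set" where
  "DFA P r T = (\<lambda>D. array_of P (filling P r T D)) ` crystal_component P r T"


section \<open>Formal power series and Schur functions\<close>

text \<open>
  A formal power series with integer coefficients in $x_1, x_2, \dots$ is given by its
  coefficients, indexed by finitely supported exponent vectors. Infinite sums of series are
  taken coefficientwise, with \<open>int\<close> carrying the discrete topology: a family of integers has a
  sum in the sense of \<open>has_sum\<close> iff only finitely many of its members are nonzero.
\<close>

type_synonym series = "(nat \<Rightarrow>\<^sub>0 nat) \<Rightarrow> int"

text \<open>\<open>monomial a\<close> is the series $\prod_i x_i^{a_i}$.\<close>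

definition monomial :: "(nat \<Rightarrow> nat) \<Rightarrow> series" where
  "monomial a e = (if Poly_Mapping.lookup e = a then 1 else 0)"

definition young :: "(nat \<Rightarrow> nat) \<Rightarrow> cell set" where
  "young \<mu> = {(i, j). 1 \<le> i \<and> 1 \<le> j \<and> j \<le> \<mu> i}"

definition SSYT :: "(nat \<Rightarrow> nat) \<Rightarrow> (cell \<Rightarrow> nat) set" where
  "SSYT \<mu> = {S \<in> young \<mu> \<rightarrow>\<^sub>E {1..}.
     (\<forall>i j. (i, j) \<in> young \<mu> \<and> (i, j + 1) \<in> young \<mu> \<longrightarrow> S (i, j) \<le> S (i, j + 1)) \<and>
     (\<forall>i j. (i, j) \<in> young \<mu> \<and> (i + 1, j) \<in> young \<mu> \<longrightarrow> S (i, j) < S (i + 1, j))}"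

definition tableau_weight :: "(nat \<Rightarrow> nat) \<Rightarrow> (cell \<Rightarrow> nat) \<Rightarrow> nat \<Rightarrow> nat" where
  "tableau_weight \<mu> S i = card {p \<in> young \<mu>. S p = i}"

definition schur :: "(nat \<Rightarrow> nat) \<Rightarrow> series" where
  "schur \<mu> e = (\<Sum>\<^sub>\<infinity>S\<in>SSYT \<mu>. monomial (tableau_weight \<mu> S) e)"

lemma has_sum_monomial:
  assumes "finite {a \<in> A. w a = Poly_Mapping.lookup e}"
  shows "((\<lambda>a. monomial (w a) e) has_sum int (card {a \<in> A. w a = Poly_Mapping.lookup e})) A"
proof -
  have "((\<lambda>a. monomial (w a) e) has_sum (\<Sum>a\<in>{a \<in> A. w a = Poly_Mapping.lookup e}. monomial (w a) e))
      {a \<in> A. w a = Poly_Mapping.lookup e}"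
    using assms by (rule has_sum_finite)
  also have "(\<Sum>a\<in>{a \<in> A. w a = Poly_Mapping.lookup e}. monomial (w a) e) = int (card {a \<in> A. w a = Poly_Mapping.lookup e})"
    by (simp add: monomial_def)
  finally show ?thesis
    by (rule has_sum_cong_neutral[THEN iffD1, rotated -1]) (auto simp: monomial_def)
qed

text \<open>The sum defining \<open>schur\<close> converges, and its coefficients are the Kostka numbers.\<close>

lemma
  assumes "finite (young \<mu>)"
  shows finite_SSYT_tableau_weight: "finite {S \<in> SSYT \<mu>. tableau_weight \<mu> S = Poly_Mapping.lookup e}"
    and schur_eq_card: "schur \<mu> e = int (card {S \<in> SSYT \<mu>. tableau_weight \<mu> S = Poly_Mapping.lookup e})"
proof -
  have "S p \<in> Poly_Mapping.keys e" if "tableau_weight \<mu> S = Poly_Mapping.lookup e" "p \<in> young \<mu>" for S p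
  proof -
    have "tableau_weight \<mu> S (S p) \<noteq> 0"
      using that(2) assms by (cases p) (auto simp: tableau_weight_def)
    then show ?thesis
      using that by (simp add: Poly_Mapping.in_keys_iff)
  qed
  then have "{S \<in> SSYT \<mu>. tableau_weight \<mu> S = Poly_Mapping.lookup e} \<subseteq> young \<mu> \<rightarrow>\<^sub>E Poly_Mapping.keys e"
    by (auto simp: SSYT_def PiE_iff extensional_def)
  then show "finite {S \<in> SSYT \<mu>. tableau_weight \<mu> S = Poly_Mapping.lookup e}"
    by (rule finite_subset) (simp add: assms finite_PiE)
  then show "schur \<mu> e = int (card {S \<in> SSYT \<mu>. tableau_weight \<mu> S = Poly_Mapping.lookup e})"
    unfolding schur_def by (intro infsumI has_sum_monomial)
qed

end

theory Submission
  imports Defs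
begin

text \<open>
  Each column of a diagram is a basis element of an exterior power of the vector representation, and
  the \<open>r\<close>-pairing is the bracketing rule for their tensor product. So the component of a diagram that is
  killed by all raising operators, with row counts \<open>\<lambda>\<close>, should have character \<open>s\<^sub>\<lambda>\<close>; the proof makes this
  explicit for columns with at most two cells, and then checks that passing from diagrams to arrays
  loses nothing.
  
  \<^item> In a tableau \<open>C(a\<^sub>k) = k\<close>, and no element of row 1 ever moves during the alignment: \<open>a\<^sub>k\<^sub>+\<^sub>1\<close> blocks
    \<open>a\<^sub>k\<close>, and no column beyond the last one ever becomes occupied. Hence the 1 alignment has image
    \<open>base m S\<close>: row 1 fills the columns \<open>1, \<dots>, m\<close>, and row 2 occupies a set \<open>S\<close> of \<open>n\<close> of
    them (\<open>aligned_alignment\<close>).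
  
  \<^item> Each operator changes one column, and the bracketing rule ties this change to the neighbouring
    columns. Consequently the inequalities \<open>interlaced\<close> between adjacent columns, which hold in
    \<open>base m S\<close>, hold in the whole component (\<open>admissible_lower\<close>). They provide the cell weakly above
    row \<open>r\<close> that the first two filling rules ask for, so a filling is a bijection onto the diagram that
    keeps every element in its column of the alignment (\<open>bij_filling\<close>). The rows of the array together
    with these columns give the diagram back, so the arrays correspond to the diagrams of the component,
    and their weights are the row counts.
  
  \<^item> Exchanging a two-cell column with a one-cell column to its right by a jeu de taquin slide keeps
    the row counts and commutes with the operators (\<open>slide_lower\<close>). It maps the component of
    \<open>base m S\<close> onto that of \<open>base m S'\<close>, where \<open>S'\<close> has the tall column one step further right.
    So all sets \<open>S\<close> of the same size give the same generating function (\<open>component_straighten\<close>).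
  
  \<^item> When the tall columns are the last \<open>n\<close> ones, the inequalities say exactly that the columns,
    read from right to left, form a semistandard tableau of shape \<open>(m, n)\<close>; and all these diagrams lie
    in one component, because \<open>base m S\<close> is the only one of them that no raising operator applies to
    (\<open>component_straight\<close>).
\<close>

section \<open>The signature rule\<close>

text \<open>
  An opening bracket is a column that meets row \<open>k\<close> but not row \<open>k + 1\<close>, a closing bracket the
  opposite. A column that meets both rows contributes 0, since its two cells pair with each other.
\<close>

definition bracket :: "nat \<Rightarrow> nat set \<Rightarrow> int" where
  "bracket k A = of_bool (k \<in> A) - of_bool (k + 1 \<in> A)"

definition col :: "cell set \<Rightarrow> nat \<Rightarrow> nat set" where
  "col D c = {i. (i, c) \<in> D}"

text \<open>
  The lattice path of the bracket word, taken just before column \<open>c\<close>. Its minima locate the cells that the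
  crystal operators move.
\<close>

definition height :: "cell set \<Rightarrow> nat \<Rightarrow> nat \<Rightarrow> int" where
  "height D k c = (\<Sum>j<c. bracket k (col D j))"

text \<open>
  After its last minimum the path stays strictly higher, so the column there is the leftmost unmatched opening
  bracket.
\<close>

definition last_min :: "cell set \<Rightarrow> nat \<Rightarrow> nat \<Rightarrow> bool" where
  "last_min D k c \<longleftrightarrow> (\<forall>j\<le>c. height D k c \<le> height D k j) \<and> (\<forall>j>c. height D k c < height D k j)"

definition lower :: "nat \<Rightarrow> nat \<Rightarrow> cell set \<Rightarrow> cell set" where
  "lower k c D = insert (k + 1, c) (D - {(k, c)})"

lemma height_0 [simp]: "height D k 0 = 0"
  by (simp add: height_def)

lemma height_Suc: "height D k (Suc c) = height D k c + bracket k (col D c)"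
  by (simp add: height_def)

lemma height_cong: "(\<And>i. i < j \<Longrightarrow> col D i = col E i) \<Longrightarrow> height D k j = height E k j"
  by (simp add: height_def)

lemma diagram_eqI: "(\<And>c. col D c = col E c) \<Longrightarrow> D = E"
  by (auto simp: col_def set_eq_iff)

lemma finite_col: "diagram D \<Longrightarrow> finite (col D c)"
  unfolding diagram_def col_def
  by (rule finite_subset[of _ "fst ` D"]) force+

text \<open>
  A pair encloses only paired cells, because this is required when it is formed. A later pair therefore
  cannot cross it, and this nesting is what allows counting the cells in an interval of columns.
\<close>

lemma pairing_structure:
  assumes "pairing D k S"
  shows "\<forall>x y. (x, y) \<in> S \<longrightarrow> (\<exists>c c'. x = (k, c) \<and> y = (k + 1, c') \<and> c \<le> c' \<and> x \<in> D \<and> y \<in> D)"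
    and "\<forall>c c' i j. ((k, c), (k + 1, c')) \<in> S \<and> (i, j) \<in> D \<and> i \<in> {k, k + 1} \<and> c \<le> j \<and> j \<le> c'
           \<longrightarrow> (i, j) \<in> Field S"
    and "\<forall>c c' d d'. ((k, c), (k + 1, c')) \<in> S \<and> ((k, d), (k + 1, d')) \<in> S \<and> c \<le> d \<and> d \<le> c'
           \<longrightarrow> d' \<le> c'"
    and "\<forall>x y z. (x, z) \<in> S \<and> (y, z) \<in> S \<longrightarrow> x = y"
    and "\<forall>x y z. (z, x) \<in> S \<and> (z, y) \<in> S \<longrightarrow> x = y"
  using assms
proof (induction)
  case empty
  { case 1 show ?case by simp }
  { case 2 show ?case by simp }
  { case 3 show ?case by simp }
  { case 4 show ?case by simp }
  { case 5 show ?case by simp }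
next
  case (step S c c')
  { case 1 show ?case using step.IH(1) step.hyps by auto }
  { case 2 show ?case
    proof (intro allI impI)
      fix d d' i j
      assume *: "((k, d), (k + 1, d')) \<in> insert ((k, c), (k + 1, c')) S \<and> (i, j) \<in> D \<and> i \<in> {k, k + 1} \<and> d \<le> j \<and> j \<le> d'"
      show "(i, j) \<in> Field (insert ((k, c), (k + 1, c')) S)"
      proof (cases "((k, d), (k + 1, d')) \<in> S")
        case True
        then have "(i, j) \<in> Field S" using * step.IH(2) by blast
        then show ?thesis by (auto simp: Field_def)
      next
        case False
        then have "d = c" "d' = c'" using * by auto
        then have "(i, j) = (k, c) \<or> (i, j) = (k + 1, c') \<or> (i, j) \<in> Field S"
          using * step.hyps by blast
        then show ?thesis by (auto simp: Field_def)
      qed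
    qed }
  { case 3 show ?case
    proof (intro allI impI)
      fix d d' e e'
      assume *: "((k, d), (k + 1, d')) \<in> insert ((k, c), (k + 1, c')) S
        \<and> ((k, e), (k + 1, e')) \<in> insert ((k, c), (k + 1, c')) S \<and> d \<le> e \<and> e \<le> d'"
      consider "((k, d), (k + 1, d')) \<in> S" "((k, e), (k + 1, e')) \<in> S"
        | "d = c" "d' = c'" "((k, e), (k + 1, e')) \<in> S"
        | "e = c" "e' = c'" "((k, d), (k + 1, d')) \<in> S"
        | "e' = d'" using * by auto
      then show "e' \<le> d'"
      proof cases
        case 1 then show ?thesis using * step.IH(3) by blast
      next
        case 2
        show ?thesis
        proof (rule ccontr)
          assume "\<not> e' \<le> d'"
          then have "(k + 1, c') \<in> Field S" using 2 * step.hyps step.IH(2) by force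
          then show False using step.hyps by blast
        qed
      next
        case 3
        then have "(k, c) \<in> Field S" using * step.hyps step.IH(2) by blast
        then show ?thesis using step.hyps by blast
      qed simp
    qed }
  { case 4 show ?case using step.IH(4) step.hyps(5,6) unfolding Field_def by blast }
  { case 5 show ?case using step.IH(5) step.hyps(5,6) unfolding Field_def by blast }
qed

lemma pairing_partner:
  assumes "pairing D k S"
  shows "(k, c) \<in> Field S \<Longrightarrow> \<exists>c'. ((k, c), (k + 1, c')) \<in> S \<and> c \<le> c' \<and> (k + 1, c') \<in> D"
    and "(k + 1, c') \<in> Field S \<Longrightarrow> \<exists>c. ((k, c), (k + 1, c')) \<in> S \<and> c \<le> c' \<and> (k, c) \<in> D"
proof -
  have *: "\<exists>c c'. x = (k, c) \<and> y = (k + 1, c') \<and> c \<le> c' \<and> x \<in> D \<and> y \<in> D" if "(x, y) \<in> S" for x y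
    using pairing_structure(1)[OF assms] that by blast
  { assume "(k, c) \<in> Field S"
    then consider y where "((k, c), y) \<in> S" | x where "(x, (k, c)) \<in> S"
      unfolding Field_def by blast
    then show "\<exists>c'. ((k, c), (k + 1, c')) \<in> S \<and> c \<le> c' \<and> (k + 1, c') \<in> D"
    proof cases
      case 1
      then show ?thesis using *[OF 1] by auto
    next
      case 2
      then show ?thesis using *[OF 2] by auto
    qed }
  { assume "(k + 1, c') \<in> Field S"
    then consider y where "((k + 1, c'), y) \<in> S" | x where "(x, (k + 1, c')) \<in> S"
      unfolding Field_def by blast
    then show "\<exists>c. ((k, c), (k + 1, c')) \<in> S \<and> c \<le> c' \<and> (k, c) \<in> D"
    proof cases
      case 1
      then show ?thesis using *[OF 1] by auto
    next
      case 2
      then show ?thesis using *[OF 2] by auto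
    qed }
qed

lemma height_diff_card:
  assumes "c \<le> c'"
  shows "height D k (Suc c') - height D k c
    = int (card {j \<in> {c..c'}. (k, j) \<in> D}) - int (card {j \<in> {c..c'}. (k + 1, j) \<in> D})"
proof -
  have "(\<Sum>j\<in>{c..c'}. bracket k (col D j)) =
     int (card {j \<in> {c..c'}. (k, j) \<in> D}) - int (card {j \<in> {c..c'}. (k + 1, j) \<in> D})"
  proof -
    have "(\<Sum>j\<in>{c..c'}. of_bool ((i, j) \<in> D)) = int (card {j \<in> {c..c'}. (i, j) \<in> D})" for i
      by (simp only: sum_of_bool_eq finite_atLeastAtMost Int_def mem_Collect_eq)
    then show ?thesis
      by (simp only: bracket_def col_def mem_Collect_eq sum_subtractf)
  qed
  moreover have "height D k (Suc c') = height D k c + (\<Sum>j\<in>{c..c'}. bracket k (col D j))"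
  proof -
    have "{..<Suc c'} = {..<c} \<union> {c..c'}" using assms by auto
    moreover have "sum f ({..<c} \<union> {c..c'}) = sum f {..<c} + sum f {c..c'}" for f :: "nat \<Rightarrow> int"
      by (rule sum.union_disjoint) auto
    ultimately show ?thesis by (simp only: height_def)
  qed
  ultimately show ?thesis by simp
qed

text \<open>
  A pair \<open>(k, c)\<close>, \<open>(k + 1, c')\<close> encloses pairs only, so the path does not rise between \<open>c\<close> and the end of
  column \<open>c'\<close>. For the converse take a maximal set of pairs: an unpaired cell of row \<open>k\<close> cannot be
  weakly left of an unpaired cell of row \<open>k + 1\<close>, since two such cells at minimal distance could still be paired.
  So if \<open>(k, c)\<close> is left over, every closing cell from column \<open>c\<close> on has its partner to the right of \<open>c\<close>,
  and the opening cells are in the majority.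
\<close>

lemma unpaired_iff_height:
  assumes "finite D" "(k, c) \<in> D"
  shows "\<not> paired D k (k, c) \<longleftrightarrow> (\<forall>c'\<ge>c. height D k c < height D k (Suc c'))"
proof
  assume unp: "\<not> paired D k (k, c)"
  have "S \<subseteq> D \<times> D" if "pairing D k S" for S
    using pairing_structure(1)[OF that] by auto
  then have "{S. pairing D k S} \<subseteq> Pow (D \<times> D)" by blast
  then have "finite {S. pairing D k S}"
    using assms(1) by (simp add: finite_subset)
  moreover have "{} \<in> {S. pairing D k S}" by (simp add: pairing.empty)
  ultimately obtain S where S: "pairing D k S" and max: "\<And>S'. pairing D k S' \<Longrightarrow> S \<subseteq> S' \<Longrightarrow> S = S'"
    using finite_has_maximal[of "{S. pairing D k S}"] by auto
  note st = pairing_structure[OF S]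
  have free: "(k, c) \<notin> Field S" using unp S by (auto simp: paired_def)
  have closed: "(k + 1, c') \<in> Field S" if "(k + 1, c') \<in> D" "c \<le> c'" for c'
  proof (rule ccontr)
    assume "(k + 1, c') \<notin> Field S"
    \<comment> \<open>candidates for one more pair; the narrowest one has only paired cells between its ends\<close>
    define Q where "Q p \<longleftrightarrow> (k, fst p) \<in> D \<and> (k + 1, snd p) \<in> D \<and> (k, fst p) \<notin> Field S
      \<and> (k + 1, snd p) \<notin> Field S \<and> fst p \<le> snd p" for p
    have "Q (c, c')" using that free \<open>(k + 1, c') \<notin> Field S\<close> assms by (simp add: Q_def)
    then obtain p where p: "Q p" and min: "\<And>q. Q q \<Longrightarrow> snd p - fst p \<le> snd q - fst q"
      using ex_has_least_nat[of Q "(c, c')" "\<lambda>p. snd p - fst p"] by blast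
    obtain d d' where pd: "p = (d, d')" by (cases p)
    have "(i, j) \<in> Field S" if ij: "(i, j) \<in> D - {(k, d), (k + 1, d')}" "i \<in> {k, k + 1}" "d \<le> j" "j \<le> d'" for i j
    proof (rule ccontr)
      assume nf: "(i, j) \<notin> Field S"
      show False
      proof (cases "i = k")
        case True
        then show False using min[of "(j, d')"] ij nf p unfolding Q_def pd by auto
      next
        case False
        then show False using min[of "(d, j)"] ij nf p unfolding Q_def pd by auto
      qed
    qed
    then have "pairing D k (insert ((k, d), (k + 1, d')) S)"
      using p S unfolding Q_def pd by (intro pairing.step) auto
    from max[OF this] have "((k, d), (k + 1, d')) \<in> S" by blast
    then show False using p unfolding Q_def pd by (auto simp: Field_def)
  qed
  show "\<forall>c'\<ge>c. height D k c < height D k (Suc c')"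
  proof (intro allI impI)
    fix c' assume cc': "c \<le> c'"
    let ?A = "{j \<in> {c..c'}. (k, j) \<in> D}" and ?B = "{j \<in> {c..c'}. (k + 1, j) \<in> D}"
    have "card ?B \<le> card (?A - {c})"
    proof (rule card_le_if_inj_on_rel[where r = "\<lambda>j' j. ((k, j), (k + 1, j')) \<in> S"])
      fix j' assume j': "j' \<in> ?B"
      then have "(k + 1, j') \<in> Field S" using closed by auto
      then obtain j where j: "((k, j), (k + 1, j')) \<in> S" "j \<le> j'" "(k, j) \<in> D"
        using pairing_partner(2)[OF S] by blast
      moreover have "c \<le> j"
      proof (rule ccontr)
        assume "\<not> c \<le> j"
        then have "((k, j), (k + 1, j')) \<in> S \<and> (k, c) \<in> D \<and> k \<in> {k, k + 1} \<and> j \<le> c \<and> c \<le> j'"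
          using j(1) assms(2) j' by auto
        then show False using st(2) free by blast
      qed
      moreover have "j \<noteq> c" using free j by (auto simp: Field_def)
      ultimately show "\<exists>j. j \<in> ?A - {c} \<and> ((k, j), (k + 1, j')) \<in> S" using j j' by auto
    next
      fix j1 j2 j assume "((k, j), (k + 1, j1)) \<in> S" "((k, j), (k + 1, j2)) \<in> S"
      then show "j1 = j2" using st(5) by blast
    qed simp
    also have "\<dots> < card ?A" using assms(2) cc' by (intro card_Diff1_less) auto
    finally show "height D k c < height D k (Suc c')"
      using height_diff_card[OF cc', of D k] by linarith
  qed
next
  assume H: "\<forall>c'\<ge>c. height D k c < height D k (Suc c')"
  show "\<not> paired D k (k, c)"
  proof
    assume "paired D k (k, c)"
    then obtain S where S: "pairing D k S" "(k, c) \<in> Field S" by (auto simp: paired_def)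
    note st = pairing_structure[OF S(1)]
    obtain c' where c': "((k, c), (k + 1, c')) \<in> S" "c \<le> c'"
      using pairing_partner(1)[OF S] by blast
    let ?A = "{j \<in> {c..c'}. (k, j) \<in> D}" and ?B = "{j \<in> {c..c'}. (k + 1, j) \<in> D}"
    have "card ?A \<le> card ?B"
    proof (rule card_le_if_inj_on_rel[where r = "\<lambda>j j'. ((k, j), (k + 1, j')) \<in> S"])
      fix j assume j: "j \<in> ?A"
      then have "((k, c), (k + 1, c')) \<in> S \<and> (k, j) \<in> D \<and> k \<in> {k, k + 1} \<and> c \<le> j \<and> j \<le> c'"
        using c'(1) by auto
      then have "(k, j) \<in> Field S" using st(2) by blast
      then obtain j' where j': "((k, j), (k + 1, j')) \<in> S" "j \<le> j'" "(k + 1, j') \<in> D"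
        using pairing_partner(1)[OF S(1)] by blast
      moreover have "j' \<le> c'"
        using st(3)[rule_format, of c c' j j'] j'(1) c'(1) j by auto
      ultimately show "\<exists>j'. j' \<in> ?B \<and> ((k, j), (k + 1, j')) \<in> S" using j j' by (intro exI[of _ j']) auto
    next
      fix j1 j2 j assume "((k, j1), (k + 1, j)) \<in> S" "((k, j2), (k + 1, j)) \<in> S"
      then show "j1 = j2" using st(4) by blast
    qed simp
    then show False using H c'(2) height_diff_card[OF c'(2), of D k] by force
  qed
qed

lemma last_min_cells:
  assumes "last_min D k c"
  shows "(k, c) \<in> D" "(k + 1, c) \<notin> D"
proof -
  have "height D k c < height D k (Suc c)" using assms unfolding last_min_def by blast
  then show "(k, c) \<in> D" "(k + 1, c) \<notin> D"
    by (auto simp: height_Suc bracket_def col_def of_bool_def split: if_splits)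
qed

lemma ex_last_argmin:
  fixes g :: "nat \<Rightarrow> int"
  shows "\<exists>c\<le>N. (\<forall>j\<le>N. g c \<le> g j) \<and> (\<forall>j\<le>N. c < j \<longrightarrow> g c < g j)"
proof (induction N)
  case (Suc N)
  then obtain c where c: "c \<le> N" "\<forall>j\<le>N. g c \<le> g j" "\<forall>j\<le>N. c < j \<longrightarrow> g c < g j" by blast
  show ?case
  proof (cases "g (Suc N) \<le> g c")
    case True
    have "g (Suc N) \<le> g j" if "j \<le> N" for j using c(2) True that by fastforce
    then show ?thesis by (intro exI[of _ "Suc N"]) (auto simp: le_Suc_eq)
  next
    case False
    then show ?thesis using c by (intro exI[of _ c]) (auto simp: le_Suc_eq)
  qed
qed auto

text \<open>
  The unpaired cells of row \<open>k\<close> are the columns whose starting height is never reached again. The leftmost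
  of them starts at the minimum of the path: otherwise the last minimum to its left would be the start of another one.
\<close>

lemma crystal_f_eq_lower:
  assumes "diagram D"
  shows "crystal_f k D = Some D' \<longleftrightarrow> (\<exists>c. last_min D k c \<and> D' = lower k c D)"
proof -
  have fin: "finite D" using assms by (simp add: diagram_def)
  define U where "U = {c. (k, c) \<in> D \<and> \<not> paired D k (k, c)}"
  have U: "c \<in> U \<longleftrightarrow> (k, c) \<in> D \<and> (\<forall>j>c. height D k c < height D k j)" for c
  proof -
    have "(\<forall>j>c. height D k c < height D k j) \<longleftrightarrow> (\<forall>j\<ge>c. height D k c < height D k (Suc j))"
    proof safe
      fix j assume "\<forall>j\<ge>c. height D k c < height D k (Suc j)" "c < j"
      then show "height D k c < height D k j" by (cases j) auto
    qed auto
    then show ?thesis using unpaired_iff_height[OF fin, of k c] by (auto simp: U_def)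
  qed
  have "U \<subseteq> snd ` D" by (force simp: U_def)
  then have finU: "finite U" using fin finite_subset by blast
  have 1: "c \<in> U \<and> Min U = c" if "last_min D k c" for c
  proof -
    have "c \<in> U" using that last_min_cells[OF that] by (simp add: U last_min_def)
    moreover have "c \<le> d" if "d \<in> U" for d
    proof (rule ccontr)
      assume "\<not> c \<le> d"
      then have "height D k c \<le> height D k d" "height D k d < height D k c"
        using \<open>d \<in> U\<close> \<open>last_min D k c\<close> unfolding U last_min_def by simp_all
      then show False by simp
    qed
    ultimately show ?thesis using finU by (auto intro: Min_eqI)
  qed
  have 2: "last_min D k (Min U)" if "U \<noteq> {}"
  proof -
    define c where "c = Min U"
    have cU: "c \<in> U" using that finU by (simp add: c_def)
    obtain d where d: "d \<le> c" "\<forall>j\<le>c. height D k d \<le> height D k j" "\<forall>j\<le>c. d < j \<longrightarrow> height D k d < height D k j"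
      using ex_last_argmin[of c "height D k"] by blast
    have "d = c"
    proof (rule ccontr)
      assume "d \<noteq> c"
      then have "d < c" using d(1) by simp
      have all: "height D k d < height D k j" if "d < j" for j
      proof (cases "j \<le> c")
        case False
        then have "height D k c < height D k j" using cU U by auto
        then show ?thesis using d \<open>d < c\<close> by force
      qed (use d that in auto)
      then have "height D k d < height D k (Suc d)" by blast
      then have "(k, d) \<in> D" by (auto simp: height_Suc bracket_def col_def of_bool_def split: if_splits)
      then have "d \<in> U" using all U by blast
      then have "c \<le> d" using Min_le[OF finU] by (simp add: c_def)
      then show False using \<open>d < c\<close> by simp
    qed
    then show ?thesis using d cU U by (auto simp: last_min_def c_def[symmetric])
  qed
  have "crystal_f k D = (if U = {} then None else Some (lower k (Min U) D))"
    by (simp add: crystal_f_def U_def[symmetric] lower_def Let_def)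
  then show ?thesis using 1 2 by (metis empty_iff option.distinct(1) option.inject)
qed

lemma diagram_lower: "diagram D \<Longrightarrow> last_min D k c \<Longrightarrow> diagram (lower k c D)"
  using last_min_cells(1)[of D k c] unfolding diagram_def lower_def by auto

lemma crystal_edge_iff:
  "crystal_edge D D' \<longleftrightarrow> diagram D \<and> (\<exists>k\<ge>1. \<exists>c. last_min D k c \<and> D' = lower k c D)"
  unfolding crystal_edge_def using diagram_lower by (metis crystal_f_eq_lower)

lemma col_lower: "col (lower k c D) j = (if j = c then insert (k + 1) (col D c - {k}) else col D j)"
  by (auto simp: col_def lower_def)

lemma height_eventually_const:
  assumes "diagram D"
  obtains N where "\<And>j. N \<le> j \<Longrightarrow> height D k j = height D k N"
proof -
  obtain N where N: "\<forall>j\<in>snd ` D. j < N"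
    using assms unfolding diagram_def by (meson finite_imageI finite_nat_set_iff_bounded)
  have "height D k j = height D k N" if "N \<le> j" for j
    using that
  proof (induction j rule: dec_induct)
    case (step n)
    then have "col D n = {}" using N by (force simp: col_def)
    then show ?case using step by (simp add: height_Suc bracket_def)
  qed simp
  then show ?thesis using that by blast
qed

text \<open>
  \<open>f\<^sub>k\<close> is defined as soon as the path ends above one of its values.
\<close>

lemma ex_last_min:
  assumes "\<forall>j\<ge>N. height D k i < height D k j"
  shows "\<exists>c. last_min D k c"
proof -
  obtain c where c: "c \<le> max i N" "\<forall>j\<le>max i N. height D k c \<le> height D k j"
      "\<forall>j\<le>max i N. c < j \<longrightarrow> height D k c < height D k j"
    using ex_last_argmin[of "max i N" "height D k"] by blast
  have "height D k c < height D k j" if "c < j" for j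
  proof (cases "j \<le> max i N")
    case False
    then have "height D k i < height D k j" using assms by auto
    then show ?thesis using c(2) by (meson le_less_trans max.cobounded1)
  qed (use c that in auto)
  moreover have "\<forall>j\<le>c. height D k c \<le> height D k j" using c(1,2) by (meson le_trans)
  ultimately show ?thesis unfolding last_min_def by blast
qed

lemma height_lower:
  assumes "(k, c) \<in> D" "(k + 1, c) \<notin> D"
  shows "height (lower k c D) k j = height D k j - (if c < j then 2 else 0)"
proof (induction j)
  case (Suc j)
  have "bracket k (col (lower k c D) j) = bracket k (col D j) - (if j = c then 2 else 0)"
    using assms by (simp add: col_lower bracket_def) (simp add: col_def)
  then show ?case using Suc by (auto simp: height_Suc)
qed simp

text \<open>
  \<open>e\<^sub>k\<close> is defined as soon as the path goes below its start: raise the closing cell on the step down to the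
  first minimum.
\<close>

lemma ex_raise:
  assumes D: "diagram D" and "k \<ge> 1" "height D k i < 0"
  shows "\<exists>D' c. diagram D' \<and> last_min D' k c \<and> D = lower k c D'"
proof -
  obtain N where N: "\<And>j. N \<le> j \<Longrightarrow> height D k j = height D k N"
    using height_eventually_const[OF D] by blast
  obtain q where q: "\<forall>j\<le>N. height D k q \<le> height D k j" using ex_last_argmin[of N "height D k"] by blast
  then have q: "\<forall>j. height D k q \<le> height D k j"
    by (metis N nat_le_linear)
  define p where "p = (LEAST p. \<forall>j. height D k p \<le> height D k j)"
  have p: "\<forall>j. height D k p \<le> height D k j" unfolding p_def by (rule LeastI[of "\<lambda>p. \<forall>j. height D k p \<le> height D k j", OF q])
  have p_first: "height D k p < height D k j" if "j < p" for j
    using not_less_Least[of j "\<lambda>p. \<forall>j. height D k p \<le> height D k j"] that p unfolding p_def[symmetric]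
    by (meson le_less_trans not_le)
  have "p \<noteq> 0"
  proof
    assume "p = 0"
    then show False using p[rule_format, of i] assms(3) by simp
  qed
  then obtain c where c: "p = Suc c" by (cases p) auto
  have "height D k (Suc c) < height D k c" using p_first c by blast
  then have cells: "(k + 1, c) \<in> D" "(k, c) \<notin> D"
    by (auto simp: height_Suc bracket_def col_def of_bool_def split: if_splits)
  define D' where "D' = insert (k, c) (D - {(k + 1, c)})"
  have D': "(k, c) \<in> D'" "(k + 1, c) \<notin> D'" by (auto simp: D'_def)
  have eq: "D = lower k c D'" using cells by (auto simp: D'_def lower_def)
  have "diagram D'" using D cells \<open>k \<ge> 1\<close> by (auto simp: diagram_def D'_def)
  have hD': "height D' k j = height D k j + (if c < j then 2 else 0)" for j
    using height_lower[OF D', of j] eq by simp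
  have hp: "height D k p = height D k c - 1" using cells by (simp add: c height_Suc bracket_def col_def)
  have "height D k c \<le> height D k j" if "j \<le> c" for j
    using p_first[of j] that c hp by simp
  moreover have "height D k c < height D k j + 2" for j
    using p[rule_format, of j] hp by simp
  ultimately have "last_min D' k c"
    by (simp add: last_min_def hD')
  then show ?thesis using \<open>diagram D'\<close> eq by blast
qed

text \<open>
  After the move the path has its first minimum right behind the moved cell, which can thus be recovered.
\<close>

lemma lower_inj:
  assumes "last_min D k c" "last_min E k d" "lower k c D = lower k d E"
  shows "D = E"
proof -
  have *: "c' = d'" if D: "last_min D k c'" and E: "last_min E k d'" and eq: "lower k c' D = lower k d' E" and "c' \<le> d'" for D E c' d'
  proof (rule ccontr)
    assume "c' \<noteq> d'"
    then have lt: "c' < d'" using that by simp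
    note hD = height_lower[OF last_min_cells[OF D]] and hE = height_lower[OF last_min_cells[OF E]]
    have "height D k (Suc d') > height D k c'" using D lt by (simp add: last_min_def)
    then have 1: "height (lower k c' D) k (Suc d') \<ge> height (lower k c' D) k (Suc c')"
      using hD[of "Suc d'"] hD[of "Suc c'"] lt last_min_cells[OF D]
      by (simp add: height_Suc col_def bracket_def)
    have "height E k (Suc d') = height E k d' + 1" using last_min_cells[OF E] by (simp add: height_Suc col_def bracket_def)
    moreover have "height E k (Suc c') \<ge> height E k d'" using E lt by (auto simp: last_min_def)
    ultimately show False using 1 hE[of "Suc d'"] hE[of "Suc c'"] lt eq by simp
  qed
  have "c = d"
    using *[OF assms(1,2,3)] *[OF assms(2,1) assms(3)[symmetric]] by (metis nat_le_linear)
  moreover have "X = insert (k, c) (lower k c X - {(k + 1, c)})" if "(k, c) \<in> X" "(k + 1, c) \<notin> X" for X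
    using that by (auto simp: lower_def)
  ultimately show ?thesis
    using assms(3) last_min_cells[OF assms(1)] last_min_cells[OF assms(2)] by metis
qed

section \<open>Adjacent columns along crystal edges\<close>

text \<open>
  Put \<open>B\<close> to the left of \<open>A\<close>. The condition says that rows increase weakly when the columns are aligned at
  the top (if \<open>B\<close> is at least as tall) and when they are aligned at the bottom (if \<open>A\<close> is at least as tall).
\<close>

definition interlaced :: "nat set \<Rightarrow> nat set \<Rightarrow> bool" where
  "interlaced A B \<longleftrightarrow> (card A \<le> card B \<longrightarrow> Min B \<le> Min A) \<and> (card B \<le> card A \<longrightarrow> Max B \<le> Max A)"

lemma interlaced_simps:
  shows "interlaced {a} {x} \<longleftrightarrow> x \<le> a"
    and "x < y \<Longrightarrow> interlaced {a} {x, y} \<longleftrightarrow> x \<le> a"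
    and "a < b \<Longrightarrow> interlaced {a, b} {x} \<longleftrightarrow> x \<le> b"
    and "a < b \<Longrightarrow> x < y \<Longrightarrow> interlaced {a, b} {x, y} \<longleftrightarrow> x \<le> a \<and> y \<le> b"
  by (auto simp: interlaced_def)

lemma card_1_or_2:
  fixes A :: "nat set"
  assumes "card A \<in> {1, 2}"
  obtains a where "A = {a}" | a b where "A = {a, b}" "a < b"
proof -
  consider "card A = 1" | "card A = 2" using assms by auto
  then show ?thesis
  proof cases
    case 1 then show ?thesis using that(1) by (auto simp: card_1_singleton_iff)
  next
    case 2
    then obtain x y where "A = {x, y}" "x \<noteq> y" by (auto simp: card_2_iff)
    then show ?thesis using that(2)[of x y] that(2)[of y x] by (metis insert_commute nat_neq_iff)
  qed
qed

text \<open>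
  The effect of \<open>f\<^sub>k\<close> on the column that it changes.
\<close>

definition flip :: "nat \<Rightarrow> nat set \<Rightarrow> nat set" where
  "flip k A = insert (k + 1) (A - {k})"

lemma flip_simps:
  shows "flip k {k} = {k + 1}"
    and "k < b \<Longrightarrow> flip k {k, b} = {k + 1, b}"
    and "a < k \<Longrightarrow> flip k {a, k} = {a, k + 1}"
  by (auto simp: flip_def)

text \<open>
  The condition on \<open>B\<close> holds when the opening bracket of \<open>A\<close> is unmatched. Replacing \<open>k\<close> by \<open>k + 1\<close> in \<open>A\<close>
  could only matter in a comparison with an entry \<open>k + 1\<close> of \<open>B\<close>, and then \<open>B\<close> contains \<open>k\<close> as well.
\<close>

lemma interlaced_flip_left:
  assumes A: "card A \<in> {1, 2}" "k \<in> A" "k + 1 \<notin> A" and B: "card B \<in> {1, 2}" "k + 1 \<in> B \<longrightarrow> k \<in> B"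
  shows "interlaced (flip k A) B \<longleftrightarrow> interlaced A B"
  using A(1)
proof (cases rule: card_1_or_2)
  case a: (1 a)
  show ?thesis using B(1)
    by (cases rule: card_1_or_2) (use A B a in \<open>auto simp: flip_simps interlaced_simps\<close>)
next
  case a: (2 a b)
  then consider "a = k" "k + 1 < b" | "b = k" using A by fastforce
  then show ?thesis
  proof cases
    case 1
    show ?thesis using B(1)
      by (cases rule: card_1_or_2) (use A B a 1 in \<open>auto simp: flip_simps interlaced_simps\<close>)
  next
    case 2
    show ?thesis using B(1)
      by (cases rule: card_1_or_2) (use A B a 2 in \<open>auto simp: flip_simps interlaced_simps\<close>)
  qed
qed

text \<open>
  The condition on \<open>A\<close> holds when the opening bracket of \<open>B\<close> is the leftmost unmatched one. The move could only
  matter in a comparison with an entry \<open>k\<close> of \<open>A\<close>, and then \<open>A\<close> contains \<open>k + 1\<close> as well.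
\<close>

lemma interlaced_flip_right:
  assumes B: "card B \<in> {1, 2}" "k \<in> B" "k + 1 \<notin> B" and A: "card A \<in> {1, 2}" "k \<in> A \<longrightarrow> k + 1 \<in> A"
  shows "interlaced A (flip k B) \<longleftrightarrow> interlaced A B"
  using B(1)
proof (cases rule: card_1_or_2)
  case a: (1 a)
  show ?thesis using A(1)
    by (cases rule: card_1_or_2) (use A B a in \<open>auto simp: flip_simps interlaced_simps\<close>)
next
  case a: (2 a b)
  then consider "a = k" "k + 1 < b" | "b = k" using B by fastforce
  then show ?thesis
  proof cases
    case 1
    show ?thesis using A(1)
      by (cases rule: card_1_or_2) (use A B a 1 in \<open>auto simp: flip_simps interlaced_simps\<close>)
  next
    case 2
    show ?thesis using A(1)
      by (cases rule: card_1_or_2) (use A B a 2 in \<open>auto simp: flip_simps interlaced_simps\<close>)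
  qed
qed

lemma col_lower_flip: "col (lower k c D) j = (if j = c then flip k (col D c) else col D j)"
  by (simp add: col_lower flip_def)

lemma card_flip: "k \<in> A \<Longrightarrow> k + 1 \<notin> A \<Longrightarrow> card (flip k A) = card A"
  unfolding flip_def
  using card_Suc_Diff1[of A k] by (cases "finite A") simp_all

lemma last_min_col:
  assumes "last_min D k c"
  shows "k \<in> col D c" "k + 1 \<notin> col D c"
  using last_min_cells[OF assms] by (simp_all add: col_def)

lemma last_min_next_col:
  assumes "last_min D k c" "k + 1 \<in> col D (Suc c)"
  shows "k \<in> col D (Suc c)"
proof (rule ccontr)
  assume "k \<notin> col D (Suc c)"
  then have "height D k (Suc (Suc c)) = height D k c"
    using assms(2) last_min_col[OF assms(1)] by (simp add: height_Suc bracket_def)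
  moreover have "height D k c < height D k (Suc (Suc c))" using assms(1) unfolding last_min_def by simp
  ultimately show False by simp
qed

lemma last_min_prev_col:
  assumes "last_min D k (Suc c)" "k \<in> col D c"
  shows "k + 1 \<in> col D c"
proof (rule ccontr)
  assume "k + 1 \<notin> col D c"
  then have "height D k (Suc c) = height D k c + 1"
    using assms(2) by (simp add: height_Suc bracket_def)
  moreover have "height D k (Suc c) \<le> height D k c" using assms(1) by (simp add: last_min_def)
  ultimately show False by simp
qed

text \<open>
  The common properties of all diagrams in the component of \<open>base m S\<close>: the column heights, which every
  crystal operator preserves, and the interlacing of adjacent columns.
\<close>

definition admissible :: "nat \<Rightarrow> nat set \<Rightarrow> cell set \<Rightarrow> bool" where
  "admissible m S D \<longleftrightarrow> diagram D \<and>
    (\<forall>c. card (col D c) = (if c \<in> {1..m} then if c \<in> S then 2 else 1 else 0)) \<and>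
    (\<forall>c\<in>{1..<m}. interlaced (col D c) (col D (Suc c)))"

text \<open>
  The equivalence makes admissibility invariant along edges in both directions, hence constant on components.
\<close>

lemma admissible_lower:
  assumes "diagram D" "last_min D k p"
  shows "admissible m S (lower k p D) \<longleftrightarrow> admissible m S D"
proof -
  have card: "card (col (lower k p D) c) = card (col D c)" for c
    using card_flip last_min_col[OF assms(2)] by (simp add: col_lower_flip)
  have "interlaced (col (lower k p D) c) (col (lower k p D) (Suc c)) \<longleftrightarrow> interlaced (col D c) (col D (Suc c))"
    if "card (col D c) \<in> {1, 2}" "card (col D (Suc c)) \<in> {1, 2}" for c
  proof -
    consider "p = c" | "p = Suc c" | "p \<noteq> c" "p \<noteq> Suc c" by blast
    then show ?thesis
    proof cases
      case 1
      have "interlaced (flip k (col D c)) (col D (Suc c)) \<longleftrightarrow> interlaced (col D c) (col D (Suc c))"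
        using that assms(2) last_min_col last_min_next_col unfolding 1 by (intro interlaced_flip_left) blast+
      then show ?thesis by (simp add: col_lower_flip 1)
    next
      case 2
      have "interlaced (col D c) (flip k (col D (Suc c))) \<longleftrightarrow> interlaced (col D c) (col D (Suc c))"
        using that assms(2) last_min_col last_min_prev_col unfolding 2 by (intro interlaced_flip_right) blast+
      then show ?thesis by (simp add: col_lower_flip 2)
    qed (simp add: col_lower_flip)
  qed
  note same = this
  have "(\<forall>c\<in>{1..<m}. interlaced (col (lower k p D) c) (col (lower k p D) (Suc c)))
      \<longleftrightarrow> (\<forall>c\<in>{1..<m}. interlaced (col D c) (col D (Suc c)))"
    if "\<forall>c. card (col D c) = (if c \<in> {1..m} then if c \<in> S then 2 else 1 else 0)"
    by (intro ball_cong refl same) (use that in auto)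
  then show ?thesis
    using card assms(1) diagram_lower[OF assms(1,2)] unfolding admissible_def by auto
qed

lemma admissible_edge: "crystal_edge D D' \<Longrightarrow> admissible m S D' \<longleftrightarrow> admissible m S D"
  using admissible_lower by (auto simp: crystal_edge_iff)

text \<open>
  Every cell of row 2 is paired with the cell above it; so no raising operator applies here.
\<close>

definition base :: "nat \<Rightarrow> nat set \<Rightarrow> cell set" where
  "base m S = {1} \<times> {1..m} \<union> {2} \<times> (S \<inter> {1..m})"

lemma col_base: "col (base m S) c = (if c \<in> {1..m} then if c \<in> S then {1, 2} else {1} else {})"
  by (auto simp: col_def base_def)

lemma admissible_base: "admissible m S (base m S)"
  unfolding admissible_def
proof (intro conjI)
  show "diagram (base m S)" by (auto simp: diagram_def base_def)
qed (auto simp: col_base interlaced_simps)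

abbreviation component :: "nat \<Rightarrow> nat set \<Rightarrow> cell set set" where
  "component m S \<equiv> {D. equivclp crystal_edge (base m S) D}"

lemma admissible_component:
  assumes "D \<in> component m S"
  shows "admissible m S D"
proof -
  have "equivclp crystal_edge (base m S) D" using assms by simp
  then show ?thesis
    by (induction rule: equivclp_induct) (use admissible_base admissible_edge in blast)+
qed

section \<open>Sliding a tall column to the right\<close>

text \<open>
  The jeu de taquin slide of a column with entries \<open>a < b\<close> against a column \<open>{x}\<close> to its right, \<open>x \<le> b\<close>: if
  \<open>x \<le> a\<close> then \<open>b\<close> passes to the right column, otherwise \<open>a\<close> does. The columns exchange their heights
  and keep their total content.
\<close>

definition slide_left :: "nat set \<Rightarrow> nat set \<Rightarrow> nat set" where
  "slide_left A B = (if Min B \<le> Min A then {Min A} else {Max A})"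

definition slide_right :: "nat set \<Rightarrow> nat set \<Rightarrow> nat set" where
  "slide_right A B = (if Min B \<le> Min A then {Min B, Max A} else {Min A, Min B})"

definition slide :: "nat \<Rightarrow> cell set \<Rightarrow> cell set" where
  "slide c D = {(i, j). if j = c then i \<in> slide_left (col D c) (col D (Suc c))
     else if j = Suc c then i \<in> slide_right (col D c) (col D (Suc c)) else (i, j) \<in> D}"

lemma col_slide:
  "col (slide c D) j = (if j = c then slide_left (col D c) (col D (Suc c))
     else if j = Suc c then slide_right (col D c) (col D (Suc c)) else col D j)"
  by (simp add: col_def slide_def)

lemma slide_simps:
  assumes "a < b"
  shows "x \<le> a \<Longrightarrow> slide_left {a, b} {x} = {a}" "x \<le> a \<Longrightarrow> slide_right {a, b} {x} = {x, b}"
    "a < x \<Longrightarrow> slide_left {a, b} {x} = {b}" "a < x \<Longrightarrow> slide_right {a, b} {x} = {a, x}"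
  using assms by (auto simp: slide_left_def slide_right_def)

lemma bracket_simps:
  "bracket k {a} = of_bool (a = k) - of_bool (a = k + 1)"
  "a \<noteq> b \<Longrightarrow> bracket k {a, b} = bracket k {a} + bracket k {b}"
  by (auto simp: bracket_def)

text \<open>
  The bracketing rule sees two adjacent columns through the rise and the minimum of their part of the path.
  The slide preserves both; only the height between the two columns may change.
\<close>

lemma slide_bracket:
  assumes "a < b" "x \<le> b"
  defines "A \<equiv> {a, b}" and "B \<equiv> {x}"
  shows "bracket k (slide_left A B) + bracket k (slide_right A B) = bracket k A + bracket k B"
    and "min (min 0 (bracket k (slide_left A B))) (bracket k A + bracket k B)
       = min (min 0 (bracket k A)) (bracket k A + bracket k B)"
proof -
  consider "x \<le> a" | "a < x" by linarith
  then show "bracket k (slide_left A B) + bracket k (slide_right A B) = bracket k A + bracket k B"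
    by cases (use assms(1,2) in \<open>auto simp: A_def B_def slide_simps bracket_simps\<close>)
  show "min (min 0 (bracket k (slide_left A B))) (bracket k A + bracket k B)
       = min (min 0 (bracket k A)) (bracket k A + bracket k B)"
  proof (cases "x \<le> a")
    case True
    then show ?thesis using assms(1,2) by (auto simp: A_def B_def slide_simps bracket_simps)
  next
    case False
    then show ?thesis using assms(1,2) by (auto simp: A_def B_def slide_simps bracket_simps)
  qed
qed

text \<open>
  Here \<open>f\<^sub>k\<close> acts on the left column. After the slide it acts on the left column if that one rises, and
  otherwise, the path being flat there, on the right one.
\<close>

lemma slide_flip_left:
  assumes "a < b" "x \<le> b"
  defines "A \<equiv> {a, b}" and "B \<equiv> {x}"
  defines "L \<equiv> slide_left A B" and "R \<equiv> slide_right A B"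
  assumes br: "bracket k A = 1" "bracket k A + bracket k B \<ge> 1"
  shows "bracket k L = 1 \<and> slide_left (flip k A) B = flip k L \<and> slide_right (flip k A) B = R
    \<or> bracket k L = 0 \<and> slide_left (flip k A) B = L \<and> slide_right (flip k A) B = flip k R"
proof -
  have "k + 1 \<noteq> b" "a = k \<or> b = k" using br(1) assms(1)
    by (auto simp: A_def bracket_simps of_bool_def split: if_splits)
  then consider "a = k" "k + 1 < b" | "b = k" using assms(1) by linarith
  then show ?thesis
  proof cases
    case 1
    then have "x \<noteq> k + 1" using br by (auto simp: A_def B_def bracket_simps)
    then consider "x \<le> k" | "k + 1 < x" by linarith
    then show ?thesis
    proof cases
      case 11: 1
      then show ?thesis using 1 by (simp add: A_def B_def L_def R_def flip_simps slide_simps bracket_simps)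
    next
      case 12: 2
      then show ?thesis using 1 assms(1,2) by (simp add: A_def B_def L_def R_def flip_simps slide_simps bracket_simps)
    qed
  next
    case 2
    consider "x \<le> a" | "a < x" by linarith
    then show ?thesis
    proof cases
      case 21: 1
      then show ?thesis using 2 assms(1,2) by (simp add: A_def B_def L_def R_def flip_simps slide_simps bracket_simps)
    next
      case 22: 2
      then show ?thesis using 2 assms(1,2) by (simp add: A_def B_def L_def R_def flip_simps slide_simps bracket_simps)
    qed
  qed
qed

text \<open>
  Here \<open>f\<^sub>k\<close> acts on the right column. After the slide it may act on the left one, if the two columns
  have exchanged a flat and a rising step.
\<close>

lemma slide_flip_right:
  assumes "a < b" "x \<le> b"
  defines "A \<equiv> {a, b}" and "B \<equiv> {x}"
  defines "L \<equiv> slide_left A B" and "R \<equiv> slide_right A B"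
  assumes br: "bracket k A \<le> 0" "bracket k B = 1"
  shows "bracket k A = 0 \<and> bracket k L = 1 \<and> slide_left A (flip k B) = flip k L \<and> slide_right A (flip k B) = R
    \<or> bracket k L = bracket k A \<and> slide_left A (flip k B) = L \<and> slide_right A (flip k B) = flip k R"
proof -
  have x: "x = k" using br(2) by (auto simp: B_def bracket_simps of_bool_def split: if_splits)
  have k: "a = k \<Longrightarrow> b = k + 1" "b \<noteq> k \<or> a = k + 1"
    using br(1) assms(1) by (auto simp: A_def bracket_simps of_bool_def split: if_splits)
  consider "a = k" | "a = k + 1" | "k + 1 < a" | "a < k" by linarith
  then show ?thesis
  proof cases
    case 1
    have "flip k {k, Suc k} = {k + 1}" by (auto simp: flip_def)
    then show ?thesis using x k 1 assms(1,2) by (simp add: A_def B_def L_def R_def flip_simps slide_simps bracket_simps)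
  next
    case 2
    then show ?thesis using x k assms(1,2) by (simp add: A_def B_def L_def R_def flip_simps slide_simps bracket_simps)
  next
    case 3
    then show ?thesis using x k assms(1,2) by (simp add: A_def B_def L_def R_def flip_simps slide_simps bracket_simps)
  next
    case 4
    then show ?thesis using x k assms(1,2) by (simp add: A_def B_def L_def R_def flip_simps slide_simps bracket_simps)
  qed
qed

text \<open>
  The paths of a diagram and of its slide differ at most in one point, and not in their minimum around it.
\<close>

lemma height_slide:
  assumes c: "col D c = {a, b}" "a < b" "col D (Suc c) = {x}" "x \<le> b"
  shows "j \<noteq> Suc c \<Longrightarrow> height (slide c D) k j = height D k j"
    and "height (slide c D) k (Suc c) = height D k c + bracket k (slide_left {a, b} {x})"
    and "min (min (height D k c) (height (slide c D) k (Suc c))) (height D k (Suc (Suc c)))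
       = min (min (height D k c) (height D k (Suc c))) (height D k (Suc (Suc c)))"
proof -
  have low: "height (slide c D) k j = height D k j" if "j \<le> c" for j
    using that by (intro height_cong) (auto simp: col_slide)
  show eq: "height (slide c D) k (Suc c) = height D k c + bracket k (slide_left {a, b} {x})"
    by (simp add: height_Suc low col_slide c)
  have hi: "height (slide c D) k j = height D k j" if "Suc (Suc c) \<le> j" for j
    using that
  proof (induction j rule: dec_induct)
    case base
    show ?case using slide_bracket(1)[OF c(2,4), of k]
      by (simp add: height_Suc low col_slide c)
  next
    case (step n)
    then show ?case by (simp add: height_Suc col_slide)
  qed
  show "height (slide c D) k j = height D k j" if "j \<noteq> Suc c"
    using low[of j] hi[of j] that by linarith
  show "min (min (height D k c) (height (slide c D) k (Suc c))) (height D k (Suc (Suc c)))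
       = min (min (height D k c) (height D k (Suc c))) (height D k (Suc (Suc c)))"
    using slide_bracket(2)[OF c(2,4), of k] unfolding eq by (simp add: height_Suc c)
qed

text \<open>
  If \<open>f\<^sub>k\<close> acts outside the two columns, the last minimum stays where it is, since the only point
  that changes does not fall below the minimum, nor reach it when it lies further right. Otherwise the last minimum stays at one of the two
  columns, and the preceding lemmas describe the result.
\<close>

lemma slide_lower:
  assumes c: "col D c = {a, b}" "a < b" "col D (Suc c) = {x}" "x \<le> b"
    and p: "last_min D k p"
  shows "\<exists>q. last_min (slide c D) k q \<and> slide c (lower k p D) = lower k q (slide c D)"
proof -
  note hs = height_slide[OF c]
  define v where "v = height D k p"
  have v2: "v < height D k j" if "p < j" for j
    using p that unfolding v_def last_min_def by blast
  have v1: "v \<le> height D k j" for j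
  proof (cases "j \<le> p")
    case True
    then show ?thesis using p unfolding v_def last_min_def by blast
  next
    case False
    then show ?thesis using v2[of j] by simp
  qed
  note v = v1 v2
  have mid: "v \<le> height (slide c D) k (Suc c)"
    using hs(3)[of k] v(1)[of c] v(1)[of "Suc c"] v(1)[of "Suc (Suc c)"] by linarith
  consider "p \<noteq> c" "p \<noteq> Suc c" | "p = c" | "p = Suc c" by blast
  then show ?thesis
  proof cases
    case 1
    have "last_min (slide c D) k p"
      unfolding last_min_def
    proof (intro conjI allI impI)
      fix j assume "j \<le> p"
      then show "height (slide c D) k p \<le> height (slide c D) k j"
        using 1 hs(1)[of p k] hs(1)[of j k] v mid by (cases "j = Suc c") (auto simp: v_def)
    next
      fix j assume j: "p < j"
      show "height (slide c D) k p < height (slide c D) k j"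
      proof (cases "j = Suc c")
        case True
        then have "p < c" using 1 j by simp
        then have "v < height (slide c D) k (Suc c)"
          using hs(3)[of k] v(2)[of c] v(2)[of "Suc c"] v(2)[of "Suc (Suc c)"] by linarith
        then show ?thesis using 1 True hs(1)[of p k] by (simp add: v_def)
      qed (use 1 hs(1)[of p k] hs(1)[of j k] v(2)[OF j] in \<open>simp add: v_def\<close>)
    qed
    moreover have "slide c (lower k p D) = lower k p (slide c D)"
      using 1 by (intro diagram_eqI) (auto simp: col_slide col_lower_flip)
    ultimately show ?thesis by blast
  next
    case 2
    have "bracket k {a, b} = 1"
      using last_min_col[OF p] c(1) 2 by (simp add: bracket_def)
    moreover have "v < height D k (Suc (Suc c))" using v(2)[of "Suc (Suc c)"] 2 by simp
    then have "bracket k {a, b} + bracket k {x} \<ge> 1"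
      using 2 c by (simp add: v_def height_Suc)
    ultimately consider
      (L) "bracket k (slide_left {a, b} {x}) = 1"
        "slide_left (flip k {a, b}) {x} = flip k (slide_left {a, b} {x})"
        "slide_right (flip k {a, b}) {x} = slide_right {a, b} {x}"
    | (R) "bracket k (slide_left {a, b} {x}) = 0"
        "slide_left (flip k {a, b}) {x} = slide_left {a, b} {x}"
        "slide_right (flip k {a, b}) {x} = flip k (slide_right {a, b} {x})"
      using slide_flip_left[OF c(2,4)] by blast
    then show ?thesis
    proof cases
      case L
      have "last_min (slide c D) k c"
        unfolding last_min_def
      proof (intro conjI allI impI)
        fix j assume "j \<le> c"
        then show "height (slide c D) k c \<le> height (slide c D) k j"
          using hs(1)[of c k] hs(1)[of j k] v(1)[of j] 2 by (simp add: v_def)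
      next
        fix j assume "c < j"
        then show "height (slide c D) k c < height (slide c D) k j"
          using hs(1)[of c k] hs(1)[of j k] v(2)[of j] 2 hs(2)[of k] L(1)
          by (cases "j = Suc c") (simp_all add: v_def)
      qed
      moreover have "slide c (lower k p D) = lower k c (slide c D)"
        using L 2 c by (intro diagram_eqI) (auto simp: col_slide col_lower_flip)
      ultimately show ?thesis by blast
    next
      case R
      have "last_min (slide c D) k (Suc c)"
        unfolding last_min_def
      proof (intro conjI allI impI)
        fix j assume "j \<le> Suc c"
        then show "height (slide c D) k (Suc c) \<le> height (slide c D) k j"
          using hs(1)[of j k] v(1)[of j] 2 hs(2)[of k] R(1)
          by (cases "j = Suc c") (simp_all add: v_def)
      next
        fix j assume "Suc c < j"
        then show "height (slide c D) k (Suc c) < height (slide c D) k j"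
          using hs(1)[of j k] v(2)[of j] 2 hs(2)[of k] R(1) by (simp add: v_def)
      qed
      moreover have "slide c (lower k p D) = lower k (Suc c) (slide c D)"
        using R 2 c by (intro diagram_eqI) (auto simp: col_slide col_lower_flip)
      ultimately show ?thesis by blast
    qed
  next
    case 3
    have "bracket k {x} = 1"
      using last_min_col[OF p] c(3) 3 by (simp add: bracket_def)
    moreover have "bracket k {a, b} \<le> 0"
      using v(1)[of c] 3 c by (simp add: v_def height_Suc)
    ultimately consider
      (L) "bracket k {a, b} = 0" "bracket k (slide_left {a, b} {x}) = 1"
        "slide_left {a, b} (flip k {x}) = flip k (slide_left {a, b} {x})"
        "slide_right {a, b} (flip k {x}) = slide_right {a, b} {x}"
    | (R) "bracket k (slide_left {a, b} {x}) = bracket k {a, b}"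
        "slide_left {a, b} (flip k {x}) = slide_left {a, b} {x}"
        "slide_right {a, b} (flip k {x}) = flip k (slide_right {a, b} {x})"
      using slide_flip_right[OF c(2,4)] by blast
    then show ?thesis
    proof cases
      case L
      have vc: "v = height D k c" using 3 L(1) c by (simp add: v_def height_Suc)
      have "last_min (slide c D) k c"
        unfolding last_min_def
      proof (intro conjI allI impI)
        fix j assume "j \<le> c"
        then show "height (slide c D) k c \<le> height (slide c D) k j"
          using hs(1)[of c k] hs(1)[of j k] v(1)[of j] vc by simp
      next
        fix j assume "c < j"
        then show "height (slide c D) k c < height (slide c D) k j"
          using hs(1)[of c k] hs(1)[of j k] v(2)[of j] 3 vc hs(2)[of k] L(2)
          by (cases "j = Suc c") simp_all
      qed
      moreover have "slide c (lower k p D) = lower k c (slide c D)"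
        using L 3 c by (intro diagram_eqI) (auto simp: col_slide col_lower_flip)
      ultimately show ?thesis by blast
    next
      case R
      have vc: "height (slide c D) k (Suc c) = v" using 3 R(1) c hs(2)[of k] by (simp add: v_def height_Suc)
      have "last_min (slide c D) k (Suc c)"
        unfolding last_min_def
      proof (intro conjI allI impI)
        fix j assume "j \<le> Suc c"
        then show "height (slide c D) k (Suc c) \<le> height (slide c D) k j"
          using hs(1)[of j k] v(1)[of j] vc by (cases "j = Suc c") simp_all
      next
        fix j assume "Suc c < j"
        then show "height (slide c D) k (Suc c) < height (slide c D) k j"
          using hs(1)[of j k] v(2)[of j] 3 vc by simp
      qed
      moreover have "slide c (lower k p D) = lower k (Suc c) (slide c D)"
        using R 3 c by (intro diagram_eqI) (auto simp: col_slide col_lower_flip)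
      ultimately show ?thesis by blast
    qed
  qed
qed

lemma admissible_descent:
  assumes "admissible m S D" "c \<in> S" "Suc c \<notin> S" "1 \<le> c" "c < m"
  obtains a b x where "col D c = {a, b}" "a < b" "col D (Suc c) = {x}" "x \<le> b"
proof -
  have cards: "card (col D c) = 2" "card (col D (Suc c)) = 1"
    and int: "interlaced (col D c) (col D (Suc c))"
    using assms by (auto simp: admissible_def)
  have "card (col D c) \<in> {1, 2}" using cards by simp
  then obtain a b where ab: "col D c = {a, b}" "a < b"
    by (cases rule: card_1_or_2) (use cards in auto)
  obtain x where x: "col D (Suc c) = {x}" using cards(2) by (auto simp: card_1_singleton_iff)
  then show ?thesis using that ab int interlaced_simps(3) by simp
qed

lemma last_min_unique:
  assumes "last_min D k p" "last_min D k q"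
  shows "p = q"
proof -
  have "\<not> p < q" if "last_min D k p" "last_min D k q" for p q
    using that unfolding last_min_def by (meson less_imp_le not_le)
  then show ?thesis using assms by (meson nat_neq_iff)
qed

text \<open>
  A tall column immediately to the left of a short one.
\<close>

locale descent =
  fixes m :: nat and S :: "nat set" and c :: nat
  assumes c: "c \<in> S" "Suc c \<notin> S" "1 \<le> c" "c < m"
begin

lemma slide_base: "slide c (base m S) = base m (insert (Suc c) (S - {c}))"
proof (rule diagram_eqI)
  have *: "slide_left {1, 2} {1} = {1}" "slide_right {1, 2} {1} = {1, 2}"
    using slide_simps[of 1 2 1] by simp_all
  show "col (slide c (base m S)) j = col (base m (insert (Suc c) (S - {c}))) j" for j
    using c * by (simp add: col_slide col_base)
qed

lemma diagram_slide:
  assumes "admissible m S D"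
  shows "diagram (slide c D)"
proof -
  obtain a b x where cols: "col D c = {a, b}" "a < b" "col D (Suc c) = {x}" "x \<le> b"
    using admissible_descent[OF assms c] by blast
  have D: "finite D" "D \<subseteq> {1..} \<times> {1..}" using assms by (auto simp: admissible_def diagram_def)
  have pos: "1 \<le> a" "1 \<le> x" using cols D(2) unfolding col_def by blast+
  have sub: "slide_left {a, b} {x} \<subseteq> {a, b}" "slide_right {a, b} {x} \<subseteq> {a, b, x}"
    using cols by (auto simp: slide_left_def slide_right_def)
  have "slide c D \<subseteq> D \<union> {a, b, x} \<times> {c, Suc c}"
    using sub by (auto simp: slide_def cols split: if_splits)
  moreover have "D \<union> {a, b, x} \<times> {c, Suc c} \<subseteq> {1..} \<times> {1..}" using D pos cols c by auto
  ultimately show ?thesis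
    using D(1) unfolding diagram_def by (meson finite.emptyI finite_SigmaI finite_UnI finite_insert finite_subset subset_trans)
qed

lemma slide_edge:
  assumes "admissible m S D" "crystal_edge D D'"
  shows "crystal_edge (slide c D) (slide c D')"
proof -
  obtain a b x where cols: "col D c = {a, b}" "a < b" "col D (Suc c) = {x}" "x \<le> b"
    using admissible_descent[OF assms(1) c] by blast
  obtain k p where k: "k \<ge> 1" "last_min D k p" "D' = lower k p D"
    using assms(2) by (auto simp: crystal_edge_iff)
  show ?thesis
    using slide_lower[OF cols k(2)] k diagram_slide[OF assms(1)] by (auto simp: crystal_edge_iff)
qed

text \<open>
  Whether \<open>f\<^sub>k\<close> is defined depends on the minimum and the final height of the path, which the slide
  preserves; so the edge that leaves the slide also exists before it, and the slide maps one to the other.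
\<close>

lemma slide_edge_from:
  assumes "admissible m S D" "crystal_edge (slide c D) E"
  shows "\<exists>D'. crystal_edge D D' \<and> E = slide c D'"
proof -
  obtain a b x where cols: "col D c = {a, b}" "a < b" "col D (Suc c) = {x}" "x \<le> b"
    using admissible_descent[OF assms(1) c] by blast
  note hs = height_slide[OF cols]
  obtain k q where k: "k \<ge> 1" and q: "last_min (slide c D) k q" "E = lower k q (slide c D)"
    using assms(2) by (auto simp: crystal_edge_iff)
  have "\<exists>i. height D k i \<le> height (slide c D) k q"
  proof (cases "q = Suc c")
    case True
    have "height D k c \<le> height (slide c D) k (Suc c) \<or> height D k (Suc c) \<le> height (slide c D) k (Suc c)
        \<or> height D k (Suc (Suc c)) \<le> height (slide c D) k (Suc c)"
      using hs(3)[of k] by linarith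
    then show ?thesis using True by blast
  next
    case False
    then show ?thesis using hs(1)[of q k] by (intro exI[of _ q]) simp
  qed
  then obtain i where i: "height D k i \<le> height (slide c D) k q" by blast
  have "height D k i < height D k j" if "max (Suc q) (Suc (Suc c)) \<le> j" for j
  proof -
    have "height (slide c D) k q < height (slide c D) k j"
      using q(1) that unfolding last_min_def by simp
    then show ?thesis using hs(1)[of j k] i that by simp
  qed
  then obtain p where p: "last_min D k p" using ex_last_min by blast
  obtain q' where q': "last_min (slide c D) k q'" "slide c (lower k p D) = lower k q' (slide c D)"
    using slide_lower[OF cols p] by blast
  have "E = slide c (lower k p D)" using last_min_unique[OF q(1) q'(1)] q' q by simp
  moreover have "crystal_edge D (lower k p D)"
    using assms(1) k p by (auto simp: crystal_edge_iff admissible_def)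
  ultimately show ?thesis by blast
qed

text \<open>
  Whether \<open>e\<^sub>k\<close> is defined depends on the minimum of the path only. The edge found this way is mapped to an
  edge of the same color into \<open>slide c D\<close>, which is unique by \<open>lower_inj\<close>.
\<close>

lemma slide_edge_to:
  assumes "admissible m S D" "crystal_edge E (slide c D)"
  shows "\<exists>D'. crystal_edge D' D \<and> E = slide c D'"
proof -
  obtain a b x where cols: "col D c = {a, b}" "a < b" "col D (Suc c) = {x}" "x \<le> b"
    using admissible_descent[OF assms(1) c] by blast
  note hs = height_slide[OF cols]
  obtain k q where k: "k \<ge> 1" and q: "last_min E k q" "slide c D = lower k q E"
    using assms(2) by (auto simp: crystal_edge_iff)
  have "height E k q \<le> 0" using q(1) unfolding last_min_def by (metis height_0 le0)
  then have neg: "height (slide c D) k (Suc q) < 0"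
    using height_lower[OF last_min_cells[OF q(1)], of "Suc q"] last_min_cells[OF q(1)] q(2)
    by (simp add: height_Suc bracket_def col_def)
  have "\<exists>i. height D k i < 0"
  proof (cases "q = c")
    case True
    have "height D k c < 0 \<or> height D k (Suc c) < 0 \<or> height D k (Suc (Suc c)) < 0"
      using hs(3)[of k] neg[unfolded True] by linarith
    then show ?thesis by blast
  next
    case False
    then show ?thesis using hs(1)[of "Suc q" k] neg by (intro exI[of _ "Suc q"]) simp
  qed
  then obtain D' p where D': "diagram D'" "last_min D' k p" "D = lower k p D'"
    using ex_raise k assms(1) by (meson admissible_def)
  then have edge: "crystal_edge D' D" using k by (auto simp: crystal_edge_iff)
  then have "admissible m S D'" using assms(1) admissible_edge by blast
  then obtain a b x where cols': "col D' c = {a, b}" "a < b" "col D' (Suc c) = {x}" "x \<le> b"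
    using admissible_descent[OF _ c] by blast
  obtain q' where "last_min (slide c D') k q'" "slide c D = lower k q' (slide c D')"
    using slide_lower[OF cols' D'(2)] D'(3) by blast
  then have "E = slide c D'" using lower_inj q by metis
  then show ?thesis using edge by blast
qed

lemma slide_inj:
  assumes "admissible m S D" "admissible m S E" "slide c D = slide c E"
  shows "D = E"
proof -
  obtain a b x where D: "col D c = {a, b}" "a < b" "col D (Suc c) = {x}" "x \<le> b"
    using admissible_descent[OF assms(1) c] by blast
  obtain a' b' x' where E: "col E c = {a', b'}" "a' < b'" "col E (Suc c) = {x'}" "x' \<le> b'"
    using admissible_descent[OF assms(2) c] by blast
  have eq: "col (slide c D) j = col (slide c E) j" for j using assms(3) by simp
  have L: "slide_left {a, b} {x} = slide_left {a', b'} {x'}"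
    using eq[of c] by (simp add: col_slide D E)
  have R: "slide_right {a, b} {x} = slide_right {a', b'} {x'}"
    using eq[of "Suc c"] by (simp add: col_slide D E)
  have "a = a' \<and> b = b' \<and> x = x'"
  proof (cases "x \<le> a"; cases "x' \<le> a'")
    assume "x \<le> a" "x' \<le> a'"
    then show ?thesis using L R D(2,4) E(2,4) by (auto simp: slide_simps doubleton_eq_iff)
  next
    assume "x \<le> a" "\<not> x' \<le> a'"
    then show ?thesis using L R D(2,4) E(2,4) by (auto simp: slide_simps doubleton_eq_iff)
  next
    assume "\<not> x \<le> a" "x' \<le> a'"
    then show ?thesis using L R D(2,4) E(2,4) by (auto simp: slide_simps doubleton_eq_iff)
  next
    assume "\<not> x \<le> a" "\<not> x' \<le> a'"
    then show ?thesis using L R D(2,4) E(2,4) by (auto simp: slide_simps doubleton_eq_iff)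
  qed
  then have "col D j = col E j" for j
    using eq[of j] D E by (cases "j = c \<or> j = Suc c") (auto simp: col_slide)
  then show ?thesis by (rule diagram_eqI)
qed

lemma slide_component:
  "bij_betw (slide c) (component m S) (component m (insert (Suc c) (S - {c})))"
  unfolding bij_betw_def
proof (intro conjI set_eqI iffI)
  show "inj_on (slide c) (component m S)"
    using slide_inj admissible_component by (meson inj_onI)
next
  let ?S = "insert (Suc c) (S - {c})"
  have "equivclp crystal_edge (base m ?S) (slide c D)" if "equivclp crystal_edge (base m S) D" for D
    using that
  proof (induction rule: equivclp_induct)
    case base
    show ?case using slide_base by simp
  next
    case (step D E)
    then have "admissible m S D" "admissible m S E"
      using admissible_component[of _ m S] equivclp_into_equivclp[of crystal_edge] by blast+
    then have "crystal_edge (slide c D) (slide c E) \<or> crystal_edge (slide c E) (slide c D)"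
      using step.hyps(2) slide_edge by blast
    then show ?case using step.IH equivclp_into_equivclp[of crystal_edge] by blast
  qed
  then show "E \<in> component m ?S" if "E \<in> slide c ` component m S" for E
    using that by blast
  have "\<exists>D. equivclp crystal_edge (base m S) D \<and> E = slide c D" if "equivclp crystal_edge (base m ?S) E" for E
    using that
  proof (induction rule: equivclp_induct)
    case base
    show ?case using slide_base by (intro exI[of _ "base m S"]) simp
  next
    case (step E E')
    then obtain D where D: "equivclp crystal_edge (base m S) D" "E = slide c D" by blast
    then have adm: "admissible m S D" using admissible_component by blast
    obtain D' where "crystal_edge D D' \<or> crystal_edge D' D" "E' = slide c D'"
      using step.hyps(2) slide_edge_from[OF adm] slide_edge_to[OF adm] D(2) by blast
    then show ?case using D(1) equivclp_into_equivclp[of crystal_edge] by blast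
  qed
  then show "E \<in> slide c ` component m S" if "E \<in> component m ?S" for E
    using that by blast
qed

end

definition row_count :: "cell set \<Rightarrow> nat \<Rightarrow> nat" where
  "row_count D i = card {c. (i, c) \<in> D}"

lemma row_count_split:
  assumes "finite {j. (i, j) \<in> D}"
  shows "row_count D i = card {j. (i, j) \<in> D \<and> j \<noteq> c \<and> j \<noteq> Suc c}
    + of_bool (i \<in> col D c) + of_bool (i \<in> col D (Suc c))"
proof -
  let ?J = "{j. (i, j) \<in> D \<and> j \<noteq> c \<and> j \<noteq> Suc c}"
  have eq: "{j. (i, j) \<in> D} = ?J \<union> {j \<in> {c}. i \<in> col D c} \<union> {j \<in> {Suc c}. i \<in> col D (Suc c)}"
    by (auto simp: col_def)
  have "finite ?J" using assms by (rule rev_finite_subset) auto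
  then have "card (?J \<union> {j \<in> {c}. i \<in> col D c} \<union> {j \<in> {Suc c}. i \<in> col D (Suc c)})
     = card ?J + card {j \<in> {c}. i \<in> col D c} + card {j \<in> {Suc c}. i \<in> col D (Suc c)}"
    by (subst card_Un_disjoint; auto)+
  moreover have "card {j \<in> {x}. Q} = of_bool Q" for x :: nat and Q by simp
  ultimately show ?thesis unfolding row_count_def eq by simp
qed

lemma finite_row: "finite D \<Longrightarrow> finite {j. (i, j) \<in> D}"
  by (rule finite_subset[of _ "snd ` D"]) force+

lemma (in descent) row_count_slide:
  assumes "admissible m S D"
  shows "row_count (slide c D) = row_count D"
proof
  fix i
  obtain a b x where cols: "col D c = {a, b}" "a < b" "col D (Suc c) = {x}" "x \<le> b"
    using admissible_descent[OF assms c] by blast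
  have "{j. (i, j) \<in> slide c D \<and> j \<noteq> c \<and> j \<noteq> Suc c} = {j. (i, j) \<in> D \<and> j \<noteq> c \<and> j \<noteq> Suc c}"
    by (auto simp: slide_def)
  moreover have "(of_bool (i \<in> slide_left {a, b} {x}) + of_bool (i \<in> slide_right {a, b} {x}) :: nat)
      = of_bool (i \<in> {a, b}) + of_bool (i \<in> {x})"
    using cols by (cases "x \<le> a") (auto simp: slide_simps)
  moreover have "finite {j. (i, j) \<in> D}" "finite {j. (i, j) \<in> slide c D}"
    using assms diagram_slide[OF assms] by (simp_all add: finite_row admissible_def diagram_def)
  ultimately show "row_count (slide c D) i = row_count D i"
    using row_count_split[of i D c] row_count_split[of i "slide c D" c]
    by (simp add: col_slide cols)
qed

text \<open>
  Each slide moves one tall column a step to the right, so repeated sliding ends with all of them at the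
  right end.
\<close>

lemma component_straighten:
  assumes "S \<subseteq> {1..m}"
  shows "\<exists>f. bij_betw f (component m S) (component m {m + 1 - card S..m})
    \<and> (\<forall>D\<in>component m S. row_count (f D) = row_count D)"
  using assms
proof (induction "\<Sum>s\<in>S. m - s" arbitrary: S rule: less_induct)
  case (less S)
  have fin: "finite S" using less.prems finite_subset by blast
  show ?case
  proof (cases "\<exists>c\<in>S. Suc c \<notin> S \<and> c < m")
    case True
    then obtain c where c: "c \<in> S" "Suc c \<notin> S" "c < m" by blast
    then interpret descent m S c using less.prems by unfold_locales auto
    let ?S = "insert (Suc c) (S - {c})"
    have card: "card ?S = card S"
      using c fin card_Suc_Diff1[OF fin c(1)] by simp
    have "(\<Sum>s\<in>?S. m - s) = (m - Suc c) + (\<Sum>s\<in>S - {c}. m - s)"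
      using c fin by simp
    also have "\<dots> < (m - c) + (\<Sum>s\<in>S - {c}. m - s)" using c by simp
    also have "\<dots> = (\<Sum>s\<in>S. m - s)" using sum.remove[OF fin c(1), of "\<lambda>s. m - s"] by simp
    finally obtain f where f: "bij_betw f (component m ?S) (component m {m + 1 - card S..m})"
        "\<forall>D\<in>component m ?S. row_count (f D) = row_count D"
      using less.hyps[of ?S] less.prems c card by auto
    have "bij_betw (f \<circ> slide c) (component m S) (component m {m + 1 - card S..m})"
      using slide_component f(1) by (rule bij_betw_trans)
    moreover have "row_count ((f \<circ> slide c) D) = row_count D" if D: "D \<in> component m S" for D
    proof -
      have "slide c D \<in> component m ?S" using bij_betwE[OF slide_component] D by blast
      then show ?thesis using f(2) row_count_slide[OF admissible_component[OF D]] by simp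
    qed
    ultimately show ?thesis by blast
  next
    case False
    have "S = {m + 1 - card S..m}"
    proof (cases "S = {}")
      case False
      have min: "Min S \<in> S" "Min S \<in> {1..m}" using fin False less.prems Min_in by blast+
      have "j \<in> S" if "Min S \<le> j" "j \<le> m" for j
        using that
      proof (induction j rule: dec_induct)
        case (step n)
        then have "n \<in> S" "n < m" by simp_all
        then show ?case using \<open>\<not> (\<exists>c\<in>S. Suc c \<notin> S \<and> c < m)\<close> by blast
      qed (use min in simp)
      then have S: "S = {Min S..m}" using less.prems fin by auto
      then have "card S = m + 1 - Min S" by (metis card_atLeastAtMost Suc_eq_plus1)
      then have "m + 1 - card S = Min S" using min(2) by simp
      then show ?thesis using S by simp
    qed simp
    then show ?thesis by (intro exI[of _ id]) auto
  qed
qed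

section \<open>Straight shapes and semistandard tableaux\<close>

lemma admissible_pos: "admissible m S D \<Longrightarrow> i \<in> col D c \<Longrightarrow> 1 \<le> i"
  by (auto simp: admissible_def diagram_def col_def)

lemma admissible_finite_col: "admissible m S D \<Longrightarrow> finite (col D c)"
  by (simp add: admissible_def finite_col)

text \<open>
  An entry \<open>k + 1\<close> without \<open>k\<close> in its column needs an unmatched \<open>k\<close> further left. In the first column this
  leaves only 1 or 1, 2; in the first tall column, preceded by columns \<open>{1}\<close>, it leaves only
  \<open>{1, 2}\<close>. All other entries are bounded by these through the interlacing.
\<close>

lemma highest_weight_straight:
  assumes adm: "admissible m {l..m} D"
    and nonneg: "\<And>k i. 1 \<le> k \<Longrightarrow> 0 \<le> height D k i"
  shows "D = base m {l..m}"
proof (rule diagram_eqI)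
  fix c
  show "col D c = col (base m {l..m}) c"
  proof (induction c rule: less_induct)
    case (less c)
    have card: "card (col D j) = (if j \<in> {1..m} then if j \<in> {l..m} then 2 else 1 else 0)" for j
      using adm by (simp add: admissible_def)
    note fin = admissible_finite_col[OF adm] and pos = admissible_pos[OF adm]
    have key: "k \<in> col D c"
      if "1 \<le> k" "k + 1 \<in> col D c" "\<And>j. j < c \<Longrightarrow> k \<notin> col D j \<and> k + 1 \<notin> col D j" for k
    proof -
      have "height D k c = 0"
        unfolding height_def by (rule sum.neutral) (use that(3) in \<open>simp add: bracket_def\<close>)
      then show ?thesis using nonneg[OF that(1), of "Suc c"] that(2)
        by (simp add: height_Suc bracket_def of_bool_def split: if_splits)
    qed
    show ?case
    proof (cases "c \<in> {1..m}")
      case False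
      then have "card (col D c) = 0" using card by simp
      then show ?thesis using fin False by (simp add: col_base)
    next
      case c: True
      have ne: "col D c \<noteq> {}" using card[of c] c by (auto split: if_splits)
      have Min_in: "Min (col D c) \<in> col D c" using fin ne by simp
      have one: "1 \<in> col D c"
      proof (cases "c = 1")
        case True
        have "col D 0 = {}" using less.IH[of 0] True by (simp add: col_base)
        show ?thesis
        proof (rule ccontr)
          assume "1 \<notin> col D c"
          then have "Min (col D c) \<noteq> 1" using Min_in by metis
          then have ge: "2 \<le> Min (col D c)" using pos[OF Min_in] by simp
          define k where "k = Min (col D c) - 1"
          have "1 \<le> k" "k + 1 \<in> col D c" using Min_in ge by (simp_all add: k_def)
          then have "k \<in> col D c"
            by (rule key) (use \<open>col D 0 = {}\<close> True in simp)
          then have "Min (col D c) \<le> Min (col D c) - 1" unfolding k_def[symmetric] by (rule Min_le[OF fin])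
          then show False using ge by simp
        qed
      next
        case False
        then obtain d where d: "c = Suc d" "d \<in> {1..<m}" using c by (cases c) auto
        have "interlaced (col D d) (col D c)" using adm d by (simp add: admissible_def)
        moreover have "card (col D d) \<le> card (col D c)" using card[of c] card[of d] d by auto
        ultimately have "Min (col D c) \<le> Min (col D d)" by (simp add: interlaced_def)
        also have "Min (col D d) = 1" using less.IH[of d] d by (simp add: col_base)
        finally show ?thesis using pos[OF Min_in] Min_in by simp
      qed
      show ?thesis
      proof (cases "c \<in> {l..m}")
        case False
        then show ?thesis using one card[of c] c by (auto simp: col_base card_1_singleton_iff)
      next
        case True
        then have "card (col D c - {1}) = 1" using one card[of c] c fin by simp
        then obtain y where "col D c - {1} = {y}" by (auto simp: card_1_singleton_iff)
        then have y: "col D c = {1, y}" "y \<noteq> 1" using one by auto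
        then have "1 \<le> y" using pos[of y c] by simp
        then have y2: "2 \<le> y" using y(2) by simp
        have "y \<le> 2"
        proof (cases "l < c \<and> 1 < c")
          case T: True
          then obtain d where d: "c = Suc d" "d \<in> {1..<m}" "d \<in> {l..m}" using c by (cases c) auto
          have "interlaced (col D d) (col D c)" using adm d by (simp add: admissible_def)
          moreover have "card (col D c) \<le> card (col D d)" using card[of c] card[of d] d True by simp
          ultimately have "Max (col D c) \<le> Max (col D d)" by (simp add: interlaced_def)
          moreover have "Max (col D d) = 2" using less.IH[of d] d by (simp add: col_base)
          ultimately show ?thesis using y by simp
        next
          case F: False
          have sub: "col D j \<subseteq> {1}" if "j < c" for j
            using less.IH[OF that] that F True by (auto simp: col_base)
          show ?thesis
          proof (rule ccontr)
            assume "\<not> y \<le> 2"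
            then have y3: "3 \<le> y" by simp
            have "y - 1 \<in> col D c"
            proof (rule key)
              fix j assume "j < c"
              then show "y - 1 \<notin> col D j \<and> y - 1 + 1 \<notin> col D j" using sub[of j] y3 by auto
            qed (use y y3 in auto)
            then show False using y y3 by auto
          qed
        qed
        then have "y = 2" using y2 by simp
        then show ?thesis using y c True by (simp add: col_base)
      qed
    qed
  qed
qed

text \<open>
  Raising lowers the sum of the row indices, so every admissible diagram can be raised until no operator
  applies, and then it is \<open>base m {l..m}\<close>.
\<close>

lemma component_straight: "component m {l..m} = {D. admissible m {l..m} D}"
proof (intro equalityI subsetI)
  fix D assume "D \<in> component m {l..m}"
  then show "D \<in> {D. admissible m {l..m} D}" using admissible_component by blast
next
  fix D assume "D \<in> {D. admissible m {l..m} D}"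
  then have "admissible m {l..m} D" by simp
  then show "D \<in> component m {l..m}"
  proof (induction "\<Sum>p\<in>D. fst p" arbitrary: D rule: less_induct)
    case (less D)
    show ?case
    proof (cases "\<exists>k\<ge>1. \<exists>i. height D k i < 0")
      case False
      then have "D = base m {l..m}" using highest_weight_straight[OF less.prems] by (meson not_le)
      then show ?thesis by simp
    next
      case True
      then obtain k i where k: "1 \<le> k" "height D k i < 0" by blast
      have "diagram D" using less.prems by (simp add: admissible_def)
      then obtain D' c where D': "diagram D'" "last_min D' k c" "D = lower k c D'"
        using ex_raise k by blast
      note cells = last_min_cells[OF D'(2)]
      have fin: "finite D'" using D'(1) by (simp add: diagram_def)
      have "(\<Sum>p\<in>D. fst p) = (k + 1) + (\<Sum>p\<in>D' - {(k, c)}. fst p)"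
        using fin cells unfolding D'(3) lower_def by simp
      also have "\<dots> > (\<Sum>p\<in>D'. fst p)" using sum.remove[OF fin cells(1), of fst] by simp
      finally have "(\<Sum>p\<in>D'. fst p) < (\<Sum>p\<in>D. fst p)" .
      moreover have edge: "crystal_edge D' D" using D' k by (auto simp: crystal_edge_iff)
      then have "admissible m {l..m} D'" using less.prems admissible_edge by blast
      ultimately have "equivclp crystal_edge (base m {l..m}) D'" using less.hyps by blast
      then show ?thesis using edge equivclp_into_equivclp[of crystal_edge] by blast
    qed
  qed
qed

locale two_row_shape =
  fixes \<mu> :: "nat \<Rightarrow> nat" and m n :: nat
  assumes shape: "\<mu> 1 = m" "\<mu> 2 = n" "\<And>i. i \<noteq> 1 \<Longrightarrow> i \<noteq> 2 \<Longrightarrow> \<mu> i = 0" and n_le_m: "n \<le> m"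
begin

lemma young_iff: "(i, j) \<in> young \<mu> \<longleftrightarrow> i = 1 \<and> j \<in> {1..m} \<or> i = 2 \<and> j \<in> {1..n}"
  using shape by (cases "i = 1"; cases "i = 2") (auto simp: young_def)

lemma young_eq: "young \<mu> = {1} \<times> {1..m} \<union> {2} \<times> {1..n}"
  using young_iff by auto

lemma finite_young: "finite (young \<mu>)"
  by (simp add: young_eq)

text \<open>
  Columns are reversed: diagrams of a component have their large entries on the left.
\<close>

definition tableau_diagram :: "(cell \<Rightarrow> nat) \<Rightarrow> cell set" where
  "tableau_diagram U = {(U (i, j), m + 1 - j) | i j. (i, j) \<in> young \<mu>}"

definition diagram_tableau :: "cell set \<Rightarrow> cell \<Rightarrow> nat" where
  "diagram_tableau D = (\<lambda>(i, j)\<in>young \<mu>. if i = 1 then Min (col D (m + 1 - j)) else Max (col D (m + 1 - j)))"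

lemma col_tableau_diagram:
  assumes "j \<in> {1..m}"
  shows "col (tableau_diagram U) (m + 1 - j) = (if j \<le> n then {U (1, j), U (2, j)} else {U (1, j)})"
proof -
  have "i \<in> col (tableau_diagram U) (m + 1 - j) \<longleftrightarrow> (\<exists>i'. (i', j) \<in> young \<mu> \<and> i = U (i', j))" for i
  proof
    assume "i \<in> col (tableau_diagram U) (m + 1 - j)"
    then obtain i' j' where "i = U (i', j')" "m + 1 - j = m + 1 - j'" "(i', j') \<in> young \<mu>"
      by (auto simp: col_def tableau_diagram_def)
    moreover from this have "j' = j" using assms n_le_m by (auto simp: young_iff)
    ultimately show "\<exists>i'. (i', j) \<in> young \<mu> \<and> i = U (i', j)" by blast
  qed (auto simp: col_def tableau_diagram_def)
  then show ?thesis using assms by (auto simp: young_iff)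
qed

lemma col_tableau_diagram_outside: "c \<notin> {1..m} \<Longrightarrow> col (tableau_diagram U) c = {}"
  using n_le_m by (auto simp: col_def tableau_diagram_def young_iff)

lemma SSYT_D:
  assumes "U \<in> SSYT \<mu>"
  shows "p \<in> young \<mu> \<Longrightarrow> 1 \<le> U p"
    and "j \<in> {1..<m} \<Longrightarrow> U (1, j) \<le> U (1, Suc j)"
    and "j \<in> {1..<n} \<Longrightarrow> U (2, j) \<le> U (2, Suc j)"
    and "j \<in> {1..n} \<Longrightarrow> U (1, j) < U (2, j)"
proof -
  show "1 \<le> U p" if "p \<in> young \<mu>" using assms that by (auto simp: SSYT_def)
  have row: "(i, j) \<in> young \<mu> \<and> (i, j + 1) \<in> young \<mu> \<longrightarrow> U (i, j) \<le> U (i, j + 1)" for i j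
    using assms by (simp add: SSYT_def)
  have column: "(i, j) \<in> young \<mu> \<and> (i + 1, j) \<in> young \<mu> \<longrightarrow> U (i, j) < U (i + 1, j)" for i j
    using assms by (simp add: SSYT_def)
  show "U (1, j) \<le> U (1, Suc j)" if "j \<in> {1..<m}" using row[of 1 j] that by (simp add: young_iff)
  show "U (2, j) \<le> U (2, Suc j)" if "j \<in> {1..<n}" using row[of 2 j] that by (simp add: young_iff)
  show "U (1, j) < U (2, j)" if "j \<in> {1..n}"
    using column[of 1 j] that n_le_m by (simp add: young_iff numeral_2_eq_2)
qed

lemma admissible_tableau_diagram:
  assumes "U \<in> SSYT \<mu>"
  shows "admissible m {m + 1 - n..m} (tableau_diagram U)"
  unfolding admissible_def
proof (intro conjI allI ballI)
  have "tableau_diagram U = (\<lambda>(i, j). (U (i, j), m + 1 - j)) ` young \<mu>"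
    by (force simp: tableau_diagram_def)
  then have "finite (tableau_diagram U)" using finite_young by simp
  moreover have "tableau_diagram U \<subseteq> {1..} \<times> {1..}"
    using SSYT_D(1)[OF assms] n_le_m by (fastforce simp: tableau_diagram_def young_iff)
  ultimately show "diagram (tableau_diagram U)" by (simp add: diagram_def)
next
  fix c
  show "card (col (tableau_diagram U) c)
     = (if c \<in> {1..m} then if c \<in> {m + 1 - n..m} then 2 else 1 else 0)"
  proof (cases "c \<in> {1..m}")
    case True
    then have j: "m + 1 - c \<in> {1..m}" "c = m + 1 - (m + 1 - c)" by auto
    have "c \<in> {m + 1 - n..m} \<longleftrightarrow> m + 1 - c \<le> n" using True by auto
    moreover have "U (1, m + 1 - c) \<noteq> U (2, m + 1 - c)" if "m + 1 - c \<le> n"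
      using SSYT_D(4)[OF assms, of "m + 1 - c"] that j by simp
    ultimately show ?thesis using col_tableau_diagram[OF j(1), of U] j(2) True by simp
  qed (simp add: col_tableau_diagram_outside)
next
  fix c assume c: "c \<in> {1..<m}"
  define j where "j = m - c"
  have j: "j \<in> {1..m}" "Suc j \<in> {1..m}" "c = m + 1 - Suc j" "Suc c = m + 1 - j"
    using c by (auto simp: j_def)
  note cols = col_tableau_diagram[OF j(2), of U, folded j(3)] col_tableau_diagram[OF j(1), of U, folded j(4)]
  consider "Suc j \<le> n" | "j = n" | "n < j" by linarith
  then show "interlaced (col (tableau_diagram U) c) (col (tableau_diagram U) (Suc c))"
  proof cases
    case 1
    then show ?thesis using SSYT_D(2-4)[OF assms, of j] SSYT_D(4)[OF assms, of "Suc j"] j(1,2)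
      by (simp add: cols interlaced_simps)
  next
    case 2
    then show ?thesis using SSYT_D(2,4)[OF assms, of j] j(1,2) by (simp add: cols interlaced_simps)
  next
    case 3
    then show ?thesis using SSYT_D(2)[OF assms, of j] j(1,2) by (simp add: cols interlaced_simps)
  qed
qed

lemma diagram_tableau_inverse:
  assumes "U \<in> SSYT \<mu>"
  shows "diagram_tableau (tableau_diagram U) = U"
proof
  fix p :: cell
  obtain i j where p: "p = (i, j)" by (cases p)
  show "diagram_tableau (tableau_diagram U) p = U p"
  proof (cases "p \<in> young \<mu>")
    case True
    then have j: "j \<in> {1..m}" using n_le_m by (auto simp: p young_iff)
    show ?thesis
      using True SSYT_D(4)[OF assms, of j] col_tableau_diagram[OF j, of U]
      by (auto simp: diagram_tableau_def p young_iff)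
  next
    case False
    have "U \<in> young \<mu> \<rightarrow>\<^sub>E {1..}" using assms by (simp add: SSYT_def)
    from PiE_arb[OF this False] show ?thesis using False by (simp add: diagram_tableau_def)
  qed
qed

lemma admissible_straight_col:
  assumes "admissible m {m + 1 - n..m} D" "j \<in> {1..m}"
  shows "if j \<le> n then \<exists>x y. x < y \<and> col D (m + 1 - j) = {x, y} else \<exists>x. col D (m + 1 - j) = {x}"
proof -
  have card: "card (col D (m + 1 - j)) = (if j \<le> n then 2 else 1)"
    using assms by (auto simp: admissible_def)
  then have "card (col D (m + 1 - j)) \<in> {1, 2}" by simp
  then show ?thesis
  proof (cases rule: card_1_or_2)
    case (1 a)
    then have "\<not> j \<le> n" using card by (simp split: if_splits)
    then show ?thesis using 1 by auto
  next
    case (2 a b)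
    then have "j \<le> n" using card by (simp split: if_splits)
    then show ?thesis using 2 by auto
  qed
qed

lemma diagram_tableau_SSYT:
  assumes adm: "admissible m {m + 1 - n..m} D"
  shows "diagram_tableau D \<in> SSYT \<mu>" "tableau_diagram (diagram_tableau D) = D"
proof -
  let ?U = "diagram_tableau D"
  note cols = admissible_straight_col[OF adm]
  have U1: "?U (1, j) = Min (col D (m + 1 - j))" if "j \<in> {1..m}" for j
    using that by (simp add: diagram_tableau_def young_iff)
  have U2: "?U (2, j) = Max (col D (m + 1 - j))" if "j \<in> {1..n}" for j
    using that by (simp add: diagram_tableau_def young_iff)
  have int: "interlaced (col D (m + 1 - Suc j)) (col D (m + 1 - j))" if "j \<in> {1..<m}" for j
  proof -
    have "m - j \<in> {1..<m}" "m + 1 - Suc j = m - j" "m + 1 - j = Suc (m - j)" using that by auto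
    then show ?thesis using adm by (metis admissible_def)
  qed
  have card: "card (col D (m + 1 - j)) = (if j \<le> n then 2 else 1)" if "j \<in> {1..m}" for j
    using that adm by (auto simp: admissible_def)
  show "?U \<in> SSYT \<mu>"
    unfolding SSYT_def mem_Collect_eq
  proof (intro conjI allI impI)
    show "?U \<in> young \<mu> \<rightarrow>\<^sub>E {1..}"
    proof (rule PiE_I)
      fix p assume p: "p \<in> young \<mu>"
      obtain i j where ij: "p = (i, j)" by (cases p)
      then have j: "j \<in> {1..m}" using p n_le_m by (auto simp: young_iff)
      have "col D (m + 1 - j) \<noteq> {}" using cols[OF j] by (auto split: if_splits)
      then have "Min (col D (m + 1 - j)) \<in> col D (m + 1 - j)" "Max (col D (m + 1 - j)) \<in> col D (m + 1 - j)"
        using admissible_finite_col[OF adm] by simp_all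
      then show "?U p \<in> {1..}"
        using p admissible_pos[OF adm] by (auto simp: diagram_tableau_def ij)
    qed (simp add: diagram_tableau_def)
  next
    fix i j assume "(i, j) \<in> young \<mu> \<and> (i, j + 1) \<in> young \<mu>"
    then consider "i = 1" "j \<in> {1..<m}" | "i = 2" "j \<in> {1..<n}" by (auto simp: young_iff)
    then show "?U (i, j) \<le> ?U (i, j + 1)"
    proof cases
      case 1
      have "card (col D (m + 1 - Suc j)) \<le> card (col D (m + 1 - j))"
        using card[of j] card[of "Suc j"] 1 by auto
      then show ?thesis using int[OF 1(2)] U1[of j] U1[of "Suc j"] 1 by (simp add: interlaced_def)
    next
      case 2
      have "card (col D (m + 1 - j)) \<le> card (col D (m + 1 - Suc j))"
        using card[of j] card[of "Suc j"] 2 n_le_m by auto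
      then show ?thesis using int[of j] U2[of j] U2[of "Suc j"] 2 n_le_m by (simp add: interlaced_def)
    qed
  next
    fix i j assume "(i, j) \<in> young \<mu> \<and> (i + 1, j) \<in> young \<mu>"
    then have i: "i = 1" "j \<in> {1..n}" "j \<in> {1..m}" using n_le_m by (auto simp: young_iff)
    then obtain x y where "x < y" "col D (m + 1 - j) = {x, y}" using cols[OF i(3)] by auto
    then have "?U (1, j) < ?U (2, j)" using U1[OF i(3)] U2[OF i(2)] by simp
    then show "?U (i, j) < ?U (i + 1, j)" by (simp add: i(1) numeral_2_eq_2)
  qed
  show "tableau_diagram ?U = D"
  proof (rule diagram_eqI)
    fix c
    show "col (tableau_diagram ?U) c = col D c"
    proof (cases "c \<in> {1..m}")
      case True
      define j where "j = m + 1 - c"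
      have j: "j \<in> {1..m}" "c = m + 1 - j" using True by (auto simp: j_def)
      have "?U (2, j) = Max (col D (m + 1 - j))" if "j \<le> n" using U2 j that by simp
      then show ?thesis
        using cols[OF j(1)] col_tableau_diagram[OF j(1), of ?U] U1[OF j(1)] unfolding j(2)[symmetric]
        by (auto split: if_splits)
    next
      case False
      then have "card (col D c) = 0" using adm by (simp add: admissible_def)
      then show ?thesis using admissible_finite_col[OF adm] col_tableau_diagram_outside[OF False] by simp
    qed
  qed
qed

lemma row_count_tableau_diagram:
  assumes "U \<in> SSYT \<mu>"
  shows "row_count (tableau_diagram U) = tableau_weight \<mu> U"
proof
  fix i
  have "inj_on (\<lambda>p. m + 1 - snd p) {p \<in> young \<mu>. U p = i}"
  proof (rule inj_onI)
    fix p q assume *: "p \<in> {p \<in> young \<mu>. U p = i}" "q \<in> {p \<in> young \<mu>. U p = i}"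
      "m + 1 - snd p = m + 1 - snd q"
    obtain i1 j i2 j2 where pq: "p = (i1, j)" "q = (i2, j2)" by (cases p; cases q)
    then have "j2 = j" using * n_le_m by (auto simp: young_iff)
    moreover have "i1 = i2"
    proof (rule ccontr)
      assume "i1 \<noteq> i2"
      then have "j \<in> {1..n}" "{i1, i2} = {1, 2}" using * pq \<open>j2 = j\<close> by (auto simp: young_iff)
      then show False using SSYT_D(4)[OF assms, of j] * pq \<open>j2 = j\<close> by (auto simp: doubleton_eq_iff)
    qed
    ultimately show "p = q" using pq by simp
  qed
  then have "card {p \<in> young \<mu>. U p = i} = card ((\<lambda>p. m + 1 - snd p) ` {p \<in> young \<mu>. U p = i})"
    by (simp add: card_image)
  also have "(\<lambda>p. m + 1 - snd p) ` {p \<in> young \<mu>. U p = i} = {c. (i, c) \<in> tableau_diagram U}"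
    by (force simp: tableau_diagram_def)
  finally show "row_count (tableau_diagram U) i = tableau_weight \<mu> U i"
    by (simp add: row_count_def tableau_weight_def)
qed

text \<open>
  The columns of an admissible diagram of straight shape are those of a semistandard tableau; sliding carries the
  correspondence to an arbitrary set of tall columns.
\<close>

lemma component_SSYT_bij:
  assumes "S \<subseteq> {1..m}" "card S = n"
  shows "\<exists>g. bij_betw g (SSYT \<mu>) (component m S) \<and> (\<forall>U\<in>SSYT \<mu>. row_count (g U) = tableau_weight \<mu> U)"
proof -
  obtain f where f: "bij_betw f (component m S) (component m {m + 1 - n..m})"
      "\<forall>D\<in>component m S. row_count (f D) = row_count D"
    using component_straighten[OF assms(1)] assms(2) by blast
  have t: "bij_betw tableau_diagram (SSYT \<mu>) (component m {m + 1 - n..m})"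
    unfolding component_straight
    by (rule bij_betwI[where g = diagram_tableau])
      (use admissible_tableau_diagram diagram_tableau_SSYT diagram_tableau_inverse in auto)
  define h where "h = inv_into (component m S) f"
  have h: "bij_betw h (component m {m + 1 - n..m}) (component m S)"
    unfolding h_def by (rule bij_betw_inv_into[OF f(1)])
  have "row_count ((h \<circ> tableau_diagram) U) = tableau_weight \<mu> U" if U: "U \<in> SSYT \<mu>" for U
  proof -
    have D: "tableau_diagram U \<in> component m {m + 1 - n..m}" using bij_betwE[OF t] U by blast
    then have "h (tableau_diagram U) \<in> component m S" using bij_betwE[OF h] by blast
    moreover have "f (h (tableau_diagram U)) = tableau_diagram U"
      unfolding h_def using bij_betw_inv_into_right[OF f(1) D] .
    ultimately show ?thesis using f(2) row_count_tableau_diagram[OF U] by (metis comp_apply)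
  qed
  moreover have "bij_betw (h \<circ> tableau_diagram) (SSYT \<mu>) (component m S)"
    using t h by (rule bij_betw_trans)
  ultimately show ?thesis by blast
qed

end

section \<open>The 1 alignment of a two-row tableau\<close>

lemma initial_segment:
  fixes J :: "nat set"
  assumes "finite J" "J \<subseteq> {1..}" "\<And>j. j \<in> J \<Longrightarrow> j > 1 \<Longrightarrow> j - 1 \<in> J"
  shows "J = {1..card J}"
proof (cases "J = {}")
  case False
  have "j \<in> J" if "1 \<le> j" "j \<le> Max J" for j
    using that(2,1)
  proof (induction j rule: inc_induct)
    case base
    then show ?case using assms(1) False by simp
  next
    case (step j)
    then show ?case using assms(3)[of "Suc j"] by simp
  qed
  then have "J = {1..Max J}" using assms(1,2) by auto
  then show ?thesis by (metis card_atLeastAtMost diff_Suc_1)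
qed simp

locale two_row_P_tableau =
  fixes P :: "'a set" and r :: "'a rel" and T :: "'a parray"
  assumes finite_P: "finite P" and order: "partial_order_on P r" and tableau: "two_row_tableau P r T"
begin

definition m :: nat where "m = wt T 1"
definition n :: nat where "n = wt T 2"
definition a :: "nat \<Rightarrow> 'a" where "a k = the (T (1, k))"
definition b :: "nat \<Rightarrow> 'a" where "b k = the (T (2, k))"

lemma array: "P_array P r T"
  using tableau by (simp add: two_row_tableau_def P_tableau_def)

lemma dom_T: "dom T \<subseteq> {1..} \<times> {1..}" and ran_T: "ran T = P" and inj_T: "inj_on T (dom T)"
  using array by (simp_all add: P_array_def)

lemma T_left: "T (i, j) = Some x \<Longrightarrow> j > 1 \<Longrightarrow> \<exists>y. T (i, j - 1) = Some y \<and> lt r y x"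
  using array unfolding P_array_def by blast

lemma T_above: "T (i, j) = Some x \<Longrightarrow> i > 1 \<Longrightarrow> \<exists>y. T (i - 1, j) = Some y \<and> \<not> lt r x y"
  using tableau unfolding two_row_tableau_def P_tableau_def by blast

lemma finite_dom_T: "finite (dom T)"
proof -
  have "T ` dom T \<subseteq> Some ` P" using ran_T by (auto simp: ran_def image_def)
  then show ?thesis using finite_P inj_T by (meson finite_imageD finite_imageI finite_subset)
qed

lemma row: "{j. (i, j) \<in> dom T} = {1..wt T i}"
  unfolding wt_def
proof (rule initial_segment)
  show "finite {j. (i, j) \<in> dom T}"
    using finite_dom_T by (rule finite_subset[rotated, OF finite_imageI[of _ snd]]) force
  show "{j. (i, j) \<in> dom T} \<subseteq> {1..}" using dom_T by auto
  show "j - 1 \<in> {j. (i, j) \<in> dom T}" if "j \<in> {j. (i, j) \<in> dom T}" "1 < j" for j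
    using that T_left[of i j] by (fastforce simp: dom_def)
qed

lemma wt_T: "i \<noteq> 1 \<Longrightarrow> i \<noteq> 2 \<Longrightarrow> wt T i = 0"
proof -
  assume "i \<noteq> 1" "i \<noteq> 2"
  then consider "i = 0" | "2 < i" by linarith
  then show "wt T i = 0"
  proof cases
    case 1
    then have "{j. (i, j) \<in> dom T} = {}" using dom_T by auto
    then show ?thesis by (simp add: wt_def)
  next
    case 2
    then show ?thesis using tableau by (simp add: two_row_tableau_def)
  qed
qed

lemma dom_T_iff: "(i, j) \<in> dom T \<longleftrightarrow> i = 1 \<and> j \<in> {1..m} \<or> i = 2 \<and> j \<in> {1..n}"
proof -
  have "(i, j) \<in> dom T \<longleftrightarrow> j \<in> {1..wt T i}" using row[of i] by blast
  then show ?thesis using wt_T[of i] by (cases "i = 1"; cases "i = 2") (auto simp: m_def n_def)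
qed

lemma T_a: "k \<in> {1..m} \<Longrightarrow> T (1, k) = Some (a k)"
  and T_b: "k \<in> {1..n} \<Longrightarrow> T (2, k) = Some (b k)"
  using dom_T_iff[of 1 k] dom_T_iff[of 2 k] by (auto simp: a_def b_def)

lemma P_eq: "P = a ` {1..m} \<union> b ` {1..n}"
proof (intro equalityI subsetI)
  fix x assume "x \<in> P"
  then obtain i j where ij: "T (i, j) = Some x" using ran_T by (auto simp: ran_def)
  then have "(i, j) \<in> dom T" by blast
  then show "x \<in> a ` {1..m} \<union> b ` {1..n}"
    using ij T_a[of j] T_b[of j] unfolding dom_T_iff by auto
next
  fix x assume "x \<in> a ` {1..m} \<union> b ` {1..n}"
  then show "x \<in> P" using ran_T T_a T_b by (blast intro: ranI)
qed

lemma T_eq_iff: "T p = Some x \<Longrightarrow> T q = Some x \<longleftrightarrow> q = p"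
  using inj_T by (metis domI inj_onD)

lemma lt_trans: "lt r x y \<Longrightarrow> lt r y z \<Longrightarrow> lt r x z"
  using order unfolding partial_order_on_def preorder_on_def by (auto dest: transD antisymD)

lemma n_le_m: "n \<le> m"
proof (cases "n = 0")
  case False
  then have "T (2, n) = Some (b n)" by (intro T_b) simp
  from T_above[OF this] have "(1, n) \<in> dom T" by auto
  then show ?thesis by (simp add: dom_T_iff)
qed simp

lemma row_less: "T (i, k) = Some x \<Longrightarrow> T (i, l) = Some y \<Longrightarrow> k < l \<Longrightarrow> lt r x y"
proof (induction l arbitrary: y)
  case (Suc l)
  have "1 \<le> k" using Suc.prems(1) dom_T by blast
  then obtain z where z: "T (i, l) = Some z" "lt r z y"
    using T_left[OF Suc.prems(2)] Suc.prems(3) by auto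
  show ?case
  proof (cases "k = l")
    case True
    then show ?thesis using z Suc.prems(1) by simp
  next
    case False
    then have "lt r x z" using Suc.IH[OF Suc.prems(1) z(1)] Suc.prems(3) by simp
    then show ?thesis using z(2) by (rule lt_trans)
  qed
qed simp

lemma a_less: "1 \<le> k \<Longrightarrow> k < l \<Longrightarrow> l \<le> m \<Longrightarrow> lt r (a k) (a l)"
  using row_less[of 1 k "a k" l "a l"] T_a by simp

lemma b_less: "1 \<le> k \<Longrightarrow> k < l \<Longrightarrow> l \<le> n \<Longrightarrow> lt r (b k) (b l)"
  using row_less[of 2 k "b k" l "b l"] T_b by simp

text \<open>
  If \<open>b\<^sub>i <\<^sub>P a\<^sub>k\<close> with \<open>i \<ge> k\<close>, then also \<open>b\<^sub>k <\<^sub>P a\<^sub>k\<close>, which a tableau forbids. So only \<open>b\<^sub>1, \<dots>, b\<^sub>k\<^sub>-\<^sub>1\<close> and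
  \<open>a\<^sub>1, \<dots>, a\<^sub>k\<^sub>-\<^sub>1\<close> can contribute to the maximum.
\<close>

lemma C_row1_eq: "k \<in> {1..m} \<Longrightarrow> C_row1 r T k = k"
proof (induction k rule: less_induct)
  case (less k)
  let ?I = "{i. \<exists>x y. T (1, k) = Some x \<and> T (2, i) = Some y \<and> lt r y x}"
  have "i < k" if i_in: "i \<in> ?I" for i
  proof (rule ccontr)
    assume "\<not> i < k"
    obtain y where y: "T (2, i) = Some y" "lt r y (a k)"
      using i_in T_a[OF less.prems] by auto
    then have i: "i \<in> {1..n}" using dom_T_iff[of 2 i] by auto
    then have k: "k \<in> {1..n}" using \<open>\<not> i < k\<close> less.prems by simp
    have "lt r (b k) (a k)"
    proof (cases "k = i")
      case True
      then show ?thesis using y T_b[OF i] by simp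
    next
      case False
      then have "lt r (b k) y" using row_less[OF T_b[OF k] y(1)] \<open>\<not> i < k\<close> by simp
      then show ?thesis using y(2) by (rule lt_trans)
    qed
    moreover have "\<not> lt r (b k) (a k)" using T_above[OF T_b[OF k]] T_a[OF less.prems] by simp
    ultimately show False by simp
  qed
  moreover have "C_row1 r T ` {1..<k} = {1..<k}" using less by simp
  ultimately have "{0} \<union> ?I \<union> C_row1 r T ` {1..<k} = {..<k}" using less.prems by auto
  moreover have "Max {..<k} = k - 1" using less.prems by (intro Max_eqI) auto
  ultimately show ?case using less.prems by (subst C_row1.simps) simp
qed

lemma phi0_a: "k \<in> {1..m} \<Longrightarrow> phi0 r T (a k) = (1, k)"
proof -
  assume k: "k \<in> {1..m}"
  have "(THE p. T p = Some (a k)) = (1, k)"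
    using T_a[OF k] T_eq_iff by (intro the_equality) auto
  then show ?thesis using C_row1_eq[OF k] by (simp add: phi0_def)
qed

lemma phi0_b: "k \<in> {1..n} \<Longrightarrow> phi0 r T (b k) = (2, k)"
proof -
  assume k: "k \<in> {1..n}"
  have "(THE p. T p = Some (b k)) = (2, k)"
    using T_b[OF k] T_eq_iff by (intro the_equality) auto
  then show ?thesis by (simp add: phi0_def)
qed

text \<open>
  The invariant of the alignment process.
\<close>

definition aligned :: "('a \<Rightarrow> cell) \<Rightarrow> bool" where
  "aligned \<phi> \<longleftrightarrow> (\<forall>k\<in>{1..m}. \<phi> (a k) = (1, k)) \<and>
    (\<forall>k\<in>{1..n}. fst (\<phi> (b k)) = 2 \<and> snd (\<phi> (b k)) \<in> {1..m}) \<and>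
    (\<forall>k l. 1 \<le> k \<longrightarrow> k < l \<longrightarrow> l \<le> n \<longrightarrow> snd (\<phi> (b k)) < snd (\<phi> (b l)))"

lemma aligned_phi0: "aligned (phi0 r T)"
  using n_le_m by (auto simp: aligned_def phi0_a phi0_b)

lemma aligned_column: "aligned \<phi> \<Longrightarrow> x \<in> P \<Longrightarrow> snd (\<phi> x) \<in> {1..m}"
  by (auto simp: aligned_def P_eq)

text \<open>
  An element of row 1 is blocked by its successor in the next column, or by the empty column after the last one. An
  element of row 2 can only move into a cell that its successor does not occupy.
\<close>

lemma aligned_movable:
  assumes "aligned \<phi>" "x \<in> movable P r \<phi>"
  obtains k where "k \<in> {1..n}" "x = b k" "snd (\<phi> (b k)) < m"
    "\<And>l. k < l \<Longrightarrow> l \<le> n \<Longrightarrow> snd (\<phi> (b k)) + 1 < snd (\<phi> (b l))"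
proof -
  from assms(2) obtain y where x: "x \<in> P" and y: "y \<in> P" "snd (\<phi> y) = snd (\<phi> x) + 1"
    and no: "\<And>z. z \<in> P \<Longrightarrow> snd (\<phi> z) = snd (\<phi> x) + 1 \<Longrightarrow> \<not> lt r x z"
    unfolding movable_def by blast
  have lt_m: "snd (\<phi> x) < m" using aligned_column[OF assms(1) y(1)] y(2) by simp
  from x consider k where "k \<in> {1..m}" "x = a k" | k where "k \<in> {1..n}" "x = b k"
    unfolding P_eq by blast
  then show ?thesis
  proof cases
    case (1 k)
    then have "snd (\<phi> x) = k" using assms(1) by (simp add: aligned_def)
    then have "Suc k \<in> {1..m}" using lt_m by simp
    then have "a (Suc k) \<in> P" "snd (\<phi> (a (Suc k))) = snd (\<phi> x) + 1"
      using assms(1) \<open>snd (\<phi> x) = k\<close> by (auto simp: P_eq aligned_def)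
    then have "\<not> lt r x (a (Suc k))" by (rule no)
    moreover have "lt r x (a (Suc k))" using a_less[of k "Suc k"] 1 \<open>Suc k \<in> {1..m}\<close> by simp
    ultimately show ?thesis by simp
  next
    case (2 k)
    have "snd (\<phi> (b k)) + 1 < snd (\<phi> (b l))" if l: "k < l" "l \<le> n" for l
    proof -
      have "snd (\<phi> (b k)) < snd (\<phi> (b l))" using assms(1) 2(1) l by (simp add: aligned_def)
      moreover have "snd (\<phi> (b l)) \<noteq> snd (\<phi> (b k)) + 1"
      proof
        assume "snd (\<phi> (b l)) = snd (\<phi> (b k)) + 1"
        moreover have "b l \<in> P" using l 2(1) by (auto simp: P_eq)
        ultimately have "\<not> lt r x (b l)" using no 2(2) by blast
        then show False using b_less[of k l] 2 l by simp
      qed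
      ultimately show ?thesis by simp
    qed
    then show ?thesis using that 2 lt_m by blast
  qed
qed

lemma align_step_moves:
  assumes "aligned \<phi>" "movable P r \<phi> \<noteq> {}"
  obtains x where "x \<in> movable P r \<phi>" "align_step P r \<phi> = \<phi>(x := (fst (\<phi> x), snd (\<phi> x) + 1))"
proof -
  obtain y where "y \<in> movable P r \<phi>" using assms(2) by blast
  moreover have "\<forall>y. y \<in> movable P r \<phi> \<longrightarrow> snd (\<phi> y) < Suc m"
    using aligned_column[OF assms(1)] by (fastforce simp: movable_def less_Suc_eq_le)
  ultimately have "arg_max (\<lambda>x. snd (\<phi> x)) (\<lambda>x. x \<in> movable P r \<phi>) \<in> movable P r \<phi>"
    by (rule arg_max_natI)
  then show ?thesis using that unfolding align_step_def Let_def by blast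
qed

lemma a_neq_b: "k \<in> {1..m} \<Longrightarrow> l \<in> {1..n} \<Longrightarrow> a k \<noteq> b l"
  using T_a[of k] T_b[of l] T_eq_iff by fastforce

lemma b_eq_iff: "k \<in> {1..n} \<Longrightarrow> l \<in> {1..n} \<Longrightarrow> b k = b l \<longleftrightarrow> k = l"
  using T_b[of k] T_b[of l] T_eq_iff by fastforce

lemma aligned_step:
  assumes "aligned \<phi>" "movable P r \<phi> \<noteq> {}"
  shows "aligned (align_step P r \<phi>)"
    and "(\<Sum>x\<in>P. m - snd (align_step P r \<phi> x)) < (\<Sum>x\<in>P. m - snd (\<phi> x))"
proof -
  obtain x where x: "x \<in> movable P r \<phi>" "align_step P r \<phi> = \<phi>(x := (fst (\<phi> x), snd (\<phi> x) + 1))"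
    using align_step_moves[OF assms] by blast
  obtain k where k: "k \<in> {1..n}" "x = b k" "snd (\<phi> (b k)) < m"
    and gap: "\<And>l. k < l \<Longrightarrow> l \<le> n \<Longrightarrow> snd (\<phi> (b k)) + 1 < snd (\<phi> (b l))"
    using aligned_movable[OF assms(1) x(1)] by blast
  let ?\<psi> = "align_step P r \<phi>"
  have \<psi>_a: "?\<psi> (a l) = \<phi> (a l)" if "l \<in> {1..m}" for l using a_neq_b[OF that k(1)] x(2) k(2) by simp
  have \<psi>_b: "?\<psi> (b l) = (fst (\<phi> (b l)), snd (\<phi> (b l)) + of_bool (l = k))" if "l \<in> {1..n}" for l
    using b_eq_iff[OF that k(1)] x(2) k(2) by simp
  show "aligned ?\<psi>"
    unfolding aligned_def
  proof (intro conjI ballI allI impI)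
    show "?\<psi> (a l) = (1, l)" if "l \<in> {1..m}" for l
      using \<psi>_a[OF that] assms(1) that by (simp add: aligned_def)
    show "fst (?\<psi> (b l)) = 2" if "l \<in> {1..n}" for l
      using \<psi>_b[OF that] assms(1) that by (simp add: aligned_def)
    show "snd (?\<psi> (b l)) \<in> {1..m}" if "l \<in> {1..n}" for l
    proof -
      have "snd (\<phi> (b l)) \<in> {1..m}" using assms(1) that by (simp add: aligned_def)
      then show ?thesis using \<psi>_b[OF that] k(3) by auto
    qed
    fix i l assume il: "1 \<le> i" "i < l" "l \<le> n"
    then have "snd (\<phi> (b i)) < snd (\<phi> (b l))" using assms(1) by (simp add: aligned_def)
    then show "snd (?\<psi> (b i)) < snd (?\<psi> (b l))"
      using \<psi>_b[of i] \<psi>_b[of l] il gap[of l] by auto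
  qed
  have xP: "x \<in> P" using x(1) by (simp add: movable_def)
  have "(\<Sum>y\<in>P - {x}. m - snd (?\<psi> y)) = (\<Sum>y\<in>P - {x}. m - snd (\<phi> y))"
    by (rule sum.cong) (simp_all add: x(2))
  moreover have "m - snd (?\<psi> x) < m - snd (\<phi> x)" using k by (simp add: x(2))
  ultimately show "(\<Sum>x\<in>P. m - snd (?\<psi> x)) < (\<Sum>x\<in>P. m - snd (\<phi> x))"
    using sum.remove[OF finite_P xP, of "\<lambda>y. m - snd (?\<psi> y)"] sum.remove[OF finite_P xP, of "\<lambda>y. m - snd (\<phi> y)"]
    by linarith
qed

text \<open>
  Every step moves an element of row 2 to the right, but never beyond column \<open>m\<close>; so the process ends.
\<close>

lemma aligned_alignment: "aligned (alignment P r T)"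
  unfolding alignment_def
proof (rule while_rule[where P = aligned and r = "Wellfounded.measure (\<lambda>\<phi>. \<Sum>x\<in>P. m - snd (\<phi> x))"])
  show "aligned (phi0 r T)" by (rule aligned_phi0)
qed (use aligned_step in auto)

definition S :: "nat set" where "S = (\<lambda>k. snd (alignment P r T (b k))) ` {1..n}"

lemma S_subset: "S \<subseteq> {1..m}"
  using aligned_alignment by (auto simp: S_def aligned_def)

lemma card_S: "card S = n"
proof -
  have "inj_on (\<lambda>k. snd (alignment P r T (b k))) {1..n}"
    using aligned_alignment unfolding aligned_def
    by (intro linorder_inj_onI) (auto simp: less_imp_neq)
  then show ?thesis by (simp add: S_def card_image)
qed

lemma alignment_image: "alignment P r T ` P = base m S"
proof -
  let ?\<phi> = "alignment P r T"
  have "(\<lambda>k. ?\<phi> (a k)) ` {1..m} = Pair 1 ` {1..m}"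
    using aligned_alignment by (intro image_cong) (auto simp: aligned_def)
  then have "?\<phi> ` a ` {1..m} = {1} \<times> {1..m}" by (auto simp: image_image)
  moreover have "(\<lambda>k. ?\<phi> (b k)) ` {1..n} = (\<lambda>k. (2, snd (?\<phi> (b k)))) ` {1..n}"
    using aligned_alignment by (intro image_cong) (auto simp: aligned_def prod_eq_iff)
  then have "?\<phi> ` b ` {1..n} = {2} \<times> S" by (auto simp: image_image S_def)
  ultimately show ?thesis using S_subset by (simp add: P_eq image_Un base_def Int_absorb2)
qed

lemma alignment_inj: "inj_on (alignment P r T) P"
proof (rule eq_card_imp_inj_on[OF finite_P])
  have "card (alignment P r T ` P) = m + n"
  proof -
    have "finite S" using S_subset finite_subset by blast
    then have "card ({1} \<times> {1..m} \<union> {2 :: nat} \<times> S) = m + n"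
      by (subst card_Un_disjoint) (auto simp: card_S)
    then show ?thesis using S_subset by (simp add: alignment_image base_def Int_absorb2)
  qed
  moreover have "card P \<le> m + n"
    unfolding P_eq by (rule order_trans[OF card_Un_le]) (metis add_mono card_image_le card_atLeastAtMost diff_Suc_1 finite_atLeastAtMost)
  ultimately show "card (alignment P r T ` P) = card P"
    using card_image_le[OF finite_P, of "alignment P r T"] by linarith
qed

lemma crystal_component_eq: "crystal_component P r T = component m S"
  by (simp add: crystal_component_def alignment_image)

sublocale shape: two_row_shape "wt T" m n
  by unfold_locales (use wt_T n_le_m in \<open>auto simp: m_def n_def\<close>)

end

section \<open>Diagram fillings and their arrays\<close>

lemma bij_betw_two:
  "x \<noteq> x' \<Longrightarrow> y \<noteq> y' \<Longrightarrow> bij_betw (the \<circ> [x \<mapsto> y, x' \<mapsto> y']) {x, x'} {y, y'}"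
  by (auto simp: bij_betw_def)

text \<open>
  Without the last assumption the maximum in the rule would range over the empty set.
\<close>

lemma place_by_bij:
  assumes X: "card X = 2" and R: "card (col D c) = 2"
    and L: "inj_on L (dom L)" and rule: "rule_applies r L X q"
    and above: "\<exists>s\<in>col D c. s \<le> fst q"
  shows "dom (place_by r D L X c q) = X"
    and "bij_betw (the \<circ> place_by r D L X c q) X (col D c \<times> {c})"
proof -
  obtain y where y: "L y = Some q" "\<exists>!x. x \<in> X \<and> lt r y x"
    using rule unfolding rule_applies_def by blast
  have THE_y: "(THE y. L y = Some q) = y"
    using y(1) L by (intro the_equality) (simp, metis domI inj_onD)
  define x where "x = (THE x. x \<in> X \<and> lt r y x)"
  have "x \<in> X" using theI'[OF y(2)] by (simp add: x_def)
  then have "card (X - {x}) = 1" using X by simp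
  then obtain x' where x': "X - {x} = {x'}" by (auto simp: card_1_singleton_iff)
  then have X_eq: "X = {x, x'}" "x \<noteq> x'" using \<open>x \<in> X\<close> by auto
  define s where "s = Max {s. s \<le> fst q \<and> (s, c) \<in> D}"
  have "s \<in> {s. s \<le> fst q \<and> (s, c) \<in> D}"
    unfolding s_def by (rule Max_in) (use above in \<open>auto simp: col_def\<close>)
  then have s: "s \<in> col D c" by (simp add: col_def)
  then have "card (col D c - {s}) = 1" using R by simp
  then obtain s' where s': "col D c - {s} = {s'}" by (auto simp: card_1_singleton_iff)
  then have col_eq: "col D c = {s, s'}" "s \<noteq> s'" using s by auto
  have eq: "place_by r D L X c q = [x \<mapsto> (s, c), x' \<mapsto> (s', c)]"
  proof -
    have "{i. (i, c) \<in> D} - {s} = {s'}" using s' by (simp only: col_def)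
    then have "the_elem ({i. (i, c) \<in> D} - {s}) = s'" by (simp only: the_elem_eq)
    moreover have "the_elem (X - {x}) = x'" using x' by (simp only: the_elem_eq)
    ultimately show ?thesis
      by (simp only: place_by_def THE_y Let_def x_def[symmetric] s_def[symmetric])
  qed
  show "dom (place_by r D L X c q) = X" unfolding eq using X_eq by auto
  have "col D c \<times> {c} = {(s, c), (s', c)}" using col_eq by auto
  then show "bij_betw (the \<circ> place_by r D L X c q) X (col D c \<times> {c})"
    unfolding eq using bij_betw_two[of x x' "(s, c)" "(s', c)"] X_eq col_eq(2) by simp
qed

context two_row_P_tableau
begin

definition entries :: "nat \<Rightarrow> 'a set" where
  "entries c = {x \<in> P. snd (alignment P r T x) = c}"

lemma bij_entries: "bij_betw (alignment P r T) (entries c) (col (base m S) c \<times> {c})"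
  unfolding bij_betw_def
proof
  show "inj_on (alignment P r T) (entries c)"
    using alignment_inj by (rule inj_on_subset) (auto simp: entries_def)
  have "alignment P r T ` entries c = {p \<in> alignment P r T ` P. snd p = c}"
    by (auto simp: entries_def)
  then show "alignment P r T ` entries c = col (base m S) c \<times> {c}"
    by (auto simp: alignment_image col_def)
qed

lemma card_entries:
  assumes "admissible m S D"
  shows "card (entries c) = card (col D c)"
proof -
  have "card (entries c) = card (col (base m S) c)"
    using bij_betw_same_card[OF bij_entries] by (simp add: card_cartesian_product)
  then show ?thesis using assms admissible_base[of m S] by (simp add: admissible_def)
qed

text \<open>
  In a two-cell column \<open>c\<close>, interlacing gives \<open>Min (col D c) \<le> Min (col D (c - 1))\<close>, because the column to the left is
  not taller. So \<open>D\<close> has a cell in column \<open>c\<close> weakly above either of the cells that the rules refer to.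
\<close>

lemma column_filling_bij:
  assumes adm: "admissible m S D" and L: "inj_on L (dom L)"
  shows "dom (column_filling P r T D L c) = entries c"
    and "bij_betw (the \<circ> column_filling P r T D L c) (entries c) (col D c \<times> {c})"
proof -
  let ?F = "column_filling P r T D L c" and ?R' = "col D (c - 1)"
  let ?top = "(Min ?R', c - 1)" and ?low = "(Max ?R', c - 1)"
  have F: "?F = (if entries c = {} then Map.empty
        else if card (entries c) = 1 then [the_elem (entries c) \<mapsto> (the_elem (col D c), c)]
        else if ?R' \<noteq> {} \<and> rule_applies r L (entries c) ?top then place_by r D L (entries c) c ?top
        else if ?R' \<noteq> {} \<and> rule_applies r L (entries c) ?low then place_by r D L (entries c) c ?low
        else [(THE x. x \<in> P \<and> alignment P r T x = (1, c)) \<mapsto> (Min (col D c), c),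
              (THE x. x \<in> P \<and> alignment P r T x = (2, c)) \<mapsto> (Max (col D c), c)])"
    unfolding column_filling_def entries_def col_def Let_def ..
  have card: "card (entries c) = card (col D c)" by (rule card_entries[OF adm])
  have fin: "finite (col D j)" for j by (rule admissible_finite_col[OF adm])
  have finE: "finite (entries c)" using finite_P by (simp add: entries_def)
  have cards: "card (col D j) = (if j \<in> {1..m} then if j \<in> S then 2 else 1 else 0)" for j
    using adm by (simp add: admissible_def)
  consider "card (col D c) = 0" | "card (col D c) = 1" | "card (col D c) = 2"
    using cards[of c] by (auto split: if_splits)
  then have "dom ?F = entries c \<and> bij_betw (the \<circ> ?F) (entries c) (col D c \<times> {c})"
  proof cases
    case 1
    then have "col D c = {}" "entries c = {}" using card fin finE by auto
    then show ?thesis by (simp add: F bij_betw_def)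
  next
    case 2
    then obtain x i where "entries c = {x}" "col D c = {i}"
      using card by (metis One_nat_def card_1_singletonE)
    then show ?thesis by (simp add: F bij_betw_def)
  next
    case 3
    then have two: "card (entries c) = 2" and ne: "entries c \<noteq> {}" using card by auto
    have c: "c \<in> {1..m}" "c \<in> S" using 3 cards[of c] by (auto split: if_splits)
    have above: "\<exists>s\<in>col D c. s \<le> Min ?R'" if "?R' \<noteq> {}"
    proof -
      have "card ?R' \<noteq> 0" using that fin by simp
      then have c1: "c - 1 \<in> {1..<m}" "Suc (c - 1) = c" using cards[of "c - 1"] c(1) by (auto split: if_splits)
      then have "interlaced ?R' (col D c)" using adm by (metis admissible_def)
      moreover have "card ?R' \<le> card (col D c)" using cards[of "c - 1"] 3 by (auto split: if_splits)
      ultimately have "Min (col D c) \<le> Min ?R'" by (simp add: interlaced_def)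
      moreover have "Min (col D c) \<in> col D c" using fin 3 by (intro Min_in) auto
      ultimately show ?thesis by blast
    qed
    have above': "\<exists>s\<in>col D c. s \<le> Max ?R'" if "?R' \<noteq> {}"
      using above[OF that] Min_le_iff[OF fin that] Max_ge[OF fin] Min_in[OF fin that] by (meson order_trans)
    note place = place_by_bij[OF two 3 L]
    consider (top) "?R' \<noteq> {}" "rule_applies r L (entries c) ?top"
      | (low) "?R' \<noteq> {}" "rule_applies r L (entries c) ?low" "\<not> rule_applies r L (entries c) ?top"
      | (none) "\<not> (?R' \<noteq> {} \<and> rule_applies r L (entries c) ?top)" "\<not> (?R' \<noteq> {} \<and> rule_applies r L (entries c) ?low)"
      by blast
    then show ?thesis
    proof cases
      case top
      then have "?F = place_by r D L (entries c) c ?top" using ne two by (simp add: F)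
      then show ?thesis using place[OF top(2)] above[OF top(1)] by simp
    next
      case low
      then have "?F = place_by r D L (entries c) c ?low" using ne two by (simp add: F)
      then show ?thesis using place[OF low(2)] above'[OF low(1)] by simp
    next
      case none
      have "col (base m S) c = {1, 2}" using c by (simp add: col_base)
      then have img: "alignment P r T ` entries c = {(1, c), (2, c)}"
        using bij_entries[of c] by (auto simp: bij_betw_def)
      then obtain x1 x2 where x: "x1 \<in> entries c" "alignment P r T x1 = (1, c)"
          "x2 \<in> entries c" "alignment P r T x2 = (2, c)"
      proof -
        have "(1, c) \<in> alignment P r T ` entries c" "(2, c) \<in> alignment P r T ` entries c"
          unfolding img by simp_all
        then show ?thesis using that by fastforce
      qed
      have "x1 \<noteq> x2" using x by auto
      have "entries c = {x1, x2}"
        using two x \<open>x1 \<noteq> x2\<close> finE by (metis card_2_iff card_subset_eq empty_subsetI insert_subset)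
      have xP: "x1 \<in> P" "x2 \<in> P" using x by (auto simp: entries_def)
      have "(THE x. x \<in> P \<and> alignment P r T x = (1, c)) = x1" "(THE x. x \<in> P \<and> alignment P r T x = (2, c)) = x2"
        using xP x inj_onD[OF alignment_inj] by (metis (mono_tags, lifting) the_equality)+
      then have F': "?F = [x1 \<mapsto> (Min (col D c), c), x2 \<mapsto> (Max (col D c), c)]"
        using none ne two by (simp only: F if_False) simp
      have "card (col D c) \<in> {1, 2}" using 3 by simp
      then obtain s t where st: "col D c = {s, t}" "s < t"
        by (cases rule: card_1_or_2) (use 3 in auto)
      have "col D c \<times> {c} = {(s, c), (t, c)}" "(s, c) \<noteq> (t, c)" using st by auto
      then show ?thesis
        using bij_betw_two[OF \<open>x1 \<noteq> x2\<close>, of "(s, c)" "(t, c)"] \<open>entries c = {x1, x2}\<close> st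
        by (auto simp: F')
    qed
  qed
  then show "dom ?F = entries c" "bij_betw (the \<circ> ?F) (entries c) (col D c \<times> {c})" by auto
qed

lemma filling_upto_inj:
  assumes adm: "admissible m S D"
  shows "inj_on (filling_upto P r T D c) (dom (filling_upto P r T D c))"
    and "\<forall>x p. filling_upto P r T D c x = Some p \<longrightarrow> snd p \<le> c"
proof (induction c)
  case 0
  { case 1 show ?case by simp }
  { case 2 show ?case by simp }
next
  case (Suc c)
  let ?L = "filling_upto P r T D c"
  let ?F = "column_filling P r T D ?L (Suc c)"
  note F = column_filling_bij[OF adm Suc.IH(1), of "Suc c"]
  have F_col: "snd p = Suc c" if "?F x = Some p" for x p
  proof -
    have "x \<in> entries (Suc c)" using F(1) that by blast
    then have "(the \<circ> ?F) x \<in> col D (Suc c) \<times> {Suc c}" using bij_betwE[OF F(2)] by blast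
    then show ?thesis using that by auto
  qed
  { case 2
    show ?case using F_col Suc.IH(2) by (fastforce simp: map_add_Some_iff) }
  { case 1
    show ?case
    proof (rule inj_onI)
      fix x y assume "x \<in> dom (filling_upto P r T D (Suc c))"
        and eq: "filling_upto P r T D (Suc c) x = filling_upto P r T D (Suc c) y"
      obtain p where "filling_upto P r T D (Suc c) x = Some p"
        using \<open>x \<in> dom (filling_upto P r T D (Suc c))\<close> by blast
      then have "(?L ++ ?F) x = Some p" "(?L ++ ?F) y = Some p" using eq by simp_all
      then consider "?F x = Some p" "?F y = Some p" | "?L x = Some p" "?L y = Some p"
        | "?F x = Some p" "?L y = Some p" | "?L x = Some p" "?F y = Some p"
        by (auto simp: map_add_Some_iff)
      then show "x = y"
      proof cases
        case 1
        then have "x \<in> entries (Suc c)" "y \<in> entries (Suc c)" using F(1) by blast+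
        moreover have "(the \<circ> ?F) x = (the \<circ> ?F) y" using 1 by simp
        ultimately show ?thesis using F(2) by (meson bij_betw_def inj_onD)
      next
        case 2
        then show ?thesis using Suc.IH(1) by (metis domI inj_onD)
      next
        case 3
        then show ?thesis using F_col Suc.IH(2) by fastforce
      next
        case 4
        then show ?thesis using F_col Suc.IH(2) by fastforce
      qed
    qed }
qed

lemma bij_filling_column:
  assumes adm: "admissible m S D"
  shows "bij_betw (filling P r T D) (entries c) (col D c \<times> {c})"
proof (cases c)
  case 0
  have "card (col D 0) = 0" using adm by (simp add: admissible_def)
  moreover have "entries 0 = {}"
    using aligned_column[OF aligned_alignment] by (force simp: entries_def)
  ultimately show ?thesis using admissible_finite_col[OF adm] 0 by (simp add: bij_betw_def)
next
  case (Suc d)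
  note F = column_filling_bij[OF adm filling_upto_inj(1)[OF adm, of d], of "Suc d"]
  have "filling P r T D x = (the \<circ> column_filling P r T D (filling_upto P r T D d) (Suc d)) x"
    if "x \<in> entries (Suc d)" for x
  proof -
    have "snd (alignment P r T x) = Suc d" using that by (simp add: entries_def)
    moreover have "x \<in> dom (column_filling P r T D (filling_upto P r T D d) (Suc d))" using F(1) that by simp
    ultimately show ?thesis by (simp add: filling_def map_add_dom_app_simps(1))
  qed
  then show ?thesis using F(2) Suc by (subst bij_betw_cong) auto
qed

lemma filling_column:
  assumes "admissible m S D" "x \<in> P"
  shows "snd (filling P r T D x) = snd (alignment P r T x)"
proof -
  have "x \<in> entries (snd (alignment P r T x))" using assms(2) by (simp add: entries_def)
  from bij_betwE[OF bij_filling_column[OF assms(1)], rule_format, OF this] show ?thesis by auto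
qed

lemma bij_filling:
  assumes adm: "admissible m S D"
  shows "bij_betw (filling P r T D) P D"
  unfolding bij_betw_def
proof (intro conjI)
  note B = bij_filling_column[OF adm]
  show "inj_on (filling P r T D) P"
  proof (rule inj_onI)
    fix x y assume xy: "x \<in> P" "y \<in> P" "filling P r T D x = filling P r T D y"
    then have "y \<in> entries (snd (alignment P r T x))"
      using filling_column[OF adm] by (simp add: entries_def) metis
    moreover have "x \<in> entries (snd (alignment P r T x))" using xy by (simp add: entries_def)
    ultimately show "x = y" using B xy(3) by (meson bij_betw_def inj_onD)
  qed
  have "P = (\<Union>c. entries c)" by (auto simp: entries_def)
  then have "filling P r T D ` P = (\<Union>c. filling P r T D ` entries c)" by blast
  also have "\<dots> = (\<Union>c. col D c \<times> {c})" using B by (simp add: bij_betw_def)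
  also have "\<dots> = D" by (auto simp: col_def)
  finally show "filling P r T D ` P = D" .
qed

end

lemma wt_array_of:
  assumes "finite P"
  shows "wt (array_of P L) i = row_count (L ` P) i"
proof -
  have "finite {c. (i, c) \<in> L ` P}"
    using assms by (simp add: finite_row)
  moreover have "{j. (i, j) \<in> dom (array_of P L)} = {1..length (sorted_list_of_set {c. (i, c) \<in> L ` P})}"
    by (auto simp: array_of_def dom_def Let_def)
  ultimately show ?thesis by (simp add: wt_def row_count_def)
qed

lemma array_of_row:
  assumes "finite P" "inj_on L P" "x \<in> P"
  shows "(\<exists>j. array_of P L (i, j) = Some x) \<longleftrightarrow> fst (L x) = i"
proof -
  define cs where "cs = sorted_list_of_set {c. (i, c) \<in> L ` P}"
  have fin: "finite {c. (i, c) \<in> L ` P}"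
    using assms(1) by (simp add: finite_row)
  have set_cs: "set cs = {c. (i, c) \<in> L ` P}" using fin by (simp add: cs_def)
  have A: "array_of P L (i, j) = (if 1 \<le> j \<and> j \<le> length cs then Some (inv_into P L (i, cs ! (j - 1))) else None)" for j
    by (simp add: array_of_def cs_def Let_def)
  show ?thesis
  proof
    assume "\<exists>j. array_of P L (i, j) = Some x"
    then obtain j where j: "1 \<le> j" "j \<le> length cs" "inv_into P L (i, cs ! (j - 1)) = x"
      by (auto simp: A split: if_splits)
    then have "cs ! (j - 1) \<in> set cs" by (intro nth_mem) simp
    then have "(i, cs ! (j - 1)) \<in> L ` P" using set_cs by blast
    then have "L x = (i, cs ! (j - 1))" using j(3) f_inv_into_f by metis
    then show "fst (L x) = i" by simp
  next
    assume i: "fst (L x) = i"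
    then have "L x = (i, snd (L x))" by auto
    then have "snd (L x) \<in> set cs" using assms(3) by (auto simp: set_cs intro: rev_image_eqI)
    then obtain j where j: "j < length cs" "cs ! j = snd (L x)" by (auto simp: in_set_conv_nth)
    have "inv_into P L (i, snd (L x)) = x" using assms(2,3) \<open>L x = (i, snd (L x))\<close> by (metis inv_into_f_f)
    then show "\<exists>j. array_of P L (i, j) = Some x"
      using j by (intro exI[of _ "Suc j"]) (simp add: A)
  qed
qed

context two_row_P_tableau
begin

text \<open>
  The array tells the row of each element, and its column is that of the alignment, for every diagram.
\<close>

lemma array_of_filling_inj: "inj_on (\<lambda>D. array_of P (filling P r T D)) (component m S)"
proof (rule inj_onI)
  fix D E assume "D \<in> component m S" "E \<in> component m S"
    and eq: "array_of P (filling P r T D) = array_of P (filling P r T E)"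
  then have adm: "admissible m S D" "admissible m S E" using admissible_component by blast+
  have "filling P r T D x = filling P r T E x" if "x \<in> P" for x
  proof (rule prod_eqI)
    show "snd (filling P r T D x) = snd (filling P r T E x)"
      using filling_column[OF adm(1) that] filling_column[OF adm(2) that] by simp
    have "(\<exists>j. array_of P (filling P r T D) (i, j) = Some x) \<longleftrightarrow> fst (filling P r T D x) = i"
      "(\<exists>j. array_of P (filling P r T E) (i, j) = Some x) \<longleftrightarrow> fst (filling P r T E x) = i" for i
      using array_of_row[OF finite_P _ that] bij_filling adm by (auto simp: bij_betw_def)
    then show "fst (filling P r T D x) = fst (filling P r T E x)" using eq by metis
  qed
  then have "filling P r T D ` P = filling P r T E ` P" by (rule image_cong[OF refl])
  then show "D = E" using bij_filling[OF adm(1)] bij_filling[OF adm(2)] by (simp add: bij_betw_def)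
qed

lemma SSYT_DFA_bij:
  "\<exists>g. bij_betw g (SSYT (wt T)) (DFA P r T) \<and> (\<forall>U\<in>SSYT (wt T). wt (g U) = tableau_weight (wt T) U)"
proof -
  let ?A = "\<lambda>D. array_of P (filling P r T D)"
  obtain g where g: "bij_betw g (SSYT (wt T)) (component m S)"
      "\<forall>U\<in>SSYT (wt T). row_count (g U) = tableau_weight (wt T) U"
    using shape.component_SSYT_bij[OF S_subset card_S] by blast
  have A: "bij_betw ?A (component m S) (DFA P r T)"
    using array_of_filling_inj by (simp add: bij_betw_def DFA_def crystal_component_eq)
  have "wt ((?A \<circ> g) U) = tableau_weight (wt T) U" if U: "U \<in> SSYT (wt T)" for U
  proof -
    have "admissible m S (g U)" using admissible_component bij_betwE[OF g(1)] U by blast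
    then have "wt (?A (g U)) = row_count (g U)"
      using wt_array_of[OF finite_P] bij_filling by (auto simp: bij_betw_def fun_eq_iff)
    then show ?thesis using g(2) U by simp
  qed
  then show ?thesis using bij_betw_trans[OF g(1) A] by blast
qed

end

theorem corollary8p13:
  fixes P :: "'a set" and r :: "'a rel" and T :: "'a parray"
  assumes "finite P"
    and "partial_order_on P r"
    and "three_plus_one_free P r"
    and "two_row_tableau P r T"
  shows "\<forall>e. ((\<lambda>A. monomial (wt A) e) has_sum schur (wt T) e) (DFA P r T)"
proof
  fix e
  interpret two_row_P_tableau P r T using assms by unfold_locales
  obtain g where g: "bij_betw g (SSYT (wt T)) (DFA P r T)"
      "\<And>U. U \<in> SSYT (wt T) \<Longrightarrow> wt (g U) = tableau_weight (wt T) U"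
    using SSYT_DFA_bij by blast
  let ?U = "{U \<in> SSYT (wt T). tableau_weight (wt T) U = Poly_Mapping.lookup e}"
  let ?A = "{A \<in> DFA P r T. wt A = Poly_Mapping.lookup e}"
  have "?A = g ` ?U"
    unfolding bij_betw_imp_surj_on[OF g(1), symmetric] using g(2) by auto
  moreover have "inj_on g ?U" using g(1) by (auto simp: bij_betw_def intro: inj_on_subset)
  ultimately have "card ?A = card ?U" "finite ?A"
    using finite_SSYT_tableau_weight[OF shape.finite_young] by (simp_all add: card_image)
  then show "((\<lambda>A. monomial (wt A) e) has_sum schur (wt T) e) (DFA P r T)"
    using has_sum_monomial[of "DFA P r T" wt e] schur_eq_card[OF shape.finite_young, of e] by simp
qed

end
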